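(* Let $t>0$ and let $$A(x,y,t)=\iint_{\mathbb{R}^2}e^{i(t\xi^3+t\xi\eta^2+x\xi+y\eta)}\,d\xi\,d\eta .$$ Let $\lambda=|x|^{3/2}t^{-1/2}>0$ and $z=y|x|^{-1}$. Then for $x>0$, $$|A(x,y,t)|\lesssim_{\alpha,\beta}t^{-2/3}\begin{cases}\langle\lambda\rangle^{-\alpha}&\text{if }|z|\le 4,\ \text{for any }\alpha\ge 0,\\ \langle\lambda|z|^{3/2}\rangle^{-\beta}&\text{if }|z|\ge 4,\ \text{for any }\beta\ge 0,\end{cases}$$ and for $x<0$, $$|A(x,y,t)|\lesssim_{\beta}t^{-2/3}\begin{cases}\langle\lambda\rangle^{-1/6}&\text{if }|z|\le 4,\\ \langle\lambda|z|^{3/2}\rangle^{-\beta}&\text{if }|z|\ge 4,\ \text{for any }\beta\ge 0.\end{cases}$$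
   Context: The integral defining $A$ is understood as an oscillatory integral (i.e. as the inverse Fourier transform, without normalizing constant, of the bounded function $e^{it(\xi^3+\xi\eta^2)}$; it is a smooth function of $(x,y)$ for $t>0$). $\langle a\rangle=(1+a^2)^{1/2}$. $\lesssim_{\alpha,\beta}$ denotes an inequality up to a multiplicative constant depending only on $\alpha,\beta$ (not on $x,y,t$). *)

theory Defs
  imports "HOL-Analysis.Analysis"
begin

text \<open>
  Schwartz functions on the plane.  The witness \<open>D j k\<close> is the mixed partial derivative of
  order \<open>j\<close> in the first and \<open>k\<close> in the second variable.  Every \<open>D j k\<close> has both partial
  derivatives, and these are again members of the (rapidly decreasing, hence bounded) family;
  so every \<open>D j k\<close> is Lipschitz continuous and \<open>\<phi>\<close> is of class \<open>C\<close>-infinity.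
\<close>

definition schwartz :: "(real \<times> real \<Rightarrow> complex) \<Rightarrow> bool" where
  "schwartz \<phi> \<longleftrightarrow>
     (\<exists>D :: nat \<Rightarrow> nat \<Rightarrow> real \<times> real \<Rightarrow> complex.
        D 0 0 = \<phi> \<and>
        (\<forall>j k x y.
           ((\<lambda>s. D j k (s, y)) has_vector_derivative D (Suc j) k (x, y)) (at x) \<and>
           ((\<lambda>s. D j k (x, s)) has_vector_derivative D j (Suc k) (x, y)) (at y)) \<and>
        (\<forall>j k m. \<exists>B. \<forall>p. (1 + norm p) ^ m * norm (D j k p) \<le> B))"

text \<open>
  Fourier inversion integral without normalizing constant; \<open>p \<bullet> q\<close> is the Euclidean inner
  product on the plane.
\<close>

definition inv_fourier :: "(real \<times> real \<Rightarrow> complex) \<Rightarrow> real \<times> real \<Rightarrow> complex" where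
  "inv_fourier \<phi> q = (LINT p|lborel. cis (p \<bullet> q) * \<phi> p)"

text \<open>
  The function \<open>u\<close> represents the inverse Fourier transform, in the sense of tempered
  distributions, of the bounded function \<open>m\<close>.  The distributional transform is defined by
  duality, pairing \<open>m\<close> with the transform of the test function.
\<close>

definition represents_inv_fourier ::
    "(real \<times> real \<Rightarrow> complex) \<Rightarrow> (real \<times> real \<Rightarrow> complex) \<Rightarrow> bool" where
  "represents_inv_fourier u m \<longleftrightarrow>
     (\<forall>\<phi>. schwartz \<phi> \<longrightarrow>
        integrable lborel (\<lambda>p. u p * \<phi> p) \<and>
        (LINT p|lborel. u p * \<phi> p) = (LINT q|lborel. m q * inv_fourier \<phi> q))"

definition multiplier :: "real \<Rightarrow> real \<times> real \<Rightarrow> complex" where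
  "multiplier t = (\<lambda>(\<xi>, \<eta>). exp (\<i> * of_real (t * (\<xi> ^ 3 + \<xi> * \<eta> ^ 2))))"

text \<open>
  The integrand of the integral for \<open>A\<close> has modulus one, so the integral is not absolutely
  convergent; it denotes the distributional inverse Fourier transform of \<open>multiplier t\<close>.
  That transform is a distribution, and its point values are those of the continuous function
  representing it.  At most one continuous function does; it is smooth for \<open>t > 0\<close>.
\<close>

definition A :: "real \<Rightarrow> real \<Rightarrow> real \<Rightarrow> complex" where
  "A x y t =
     (THE u. continuous_on UNIV u \<and> represents_inv_fourier u (multiplier t)) (x, y)"

definition japanese :: "real \<Rightarrow> real"  (\<open>\<langle>_\<rangle>\<close>) where
  "\<langle>a\<rangle> = (1 + a\<^sup>2) powr (1 / 2)"

end

theory Submission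
  imports Defs "HOL-Complex_Analysis.Complex_Analysis" "HOL-Probability.Probability" "HOL-Real_Asymp.Real_Asymp"
begin

text \<open>
  In the coordinates \<open>\<xi> = k (a + b) / 2\<close>, \<open>\<eta> = k \<surd>3 (a - b) / 2\<close> with \<open>t k\<^sup>3 = 2\<close> the phase
  \<open>t (\<xi>\<^sup>3 + \<xi> \<eta>\<^sup>2)\<close> becomes \<open>a\<^sup>3 + b\<^sup>3\<close>, so \<open>A x y t\<close> is a multiple, of size
  \<open>t powr (-2/3)\<close>, of a product of two Airy functions with arguments \<open>k (x \<plusminus> \<surd>3 y) / 2\<close>.
  Moving the contour of the Airy integral into the upper half plane makes it absolutely convergent
  and gives the decay \<open>exp (- s)\<close>; moving it through the stationary points gives the
  bound \<open>\<bar>s\<bar> powr (-1/4)\<close> for \<open>s < 0\<close>.  The larger argument is at least of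
  size \<open>t powr (-1/3) * max x \<bar>y\<bar>\<close> if \<open>x > 0\<close> or \<open>\<bar>y\<bar> \<ge> 4 \<bar>x\<bar>\<close>, and the smaller one
  is at most \<open>k x / 2\<close>, which yields all the claimed estimates.

  The shifted Airy integrals also regularise the multiplier, so that the product of Airy functions
  is identified as its distributional inverse transform by Fubini and dominated convergence.
\<close>

subsection \<open>The Airy function\<close>

lemma has_bochner_integral_gaussian:
  fixes k m :: real
  assumes "0 < k"
  shows "has_bochner_integral lborel (\<lambda>x. exp (- k * (x - m)\<^sup>2)) (sqrt (pi / k))"
proof -
  \<comment> \<open>With variance 1/(2k) the normal density is a constant multiple of the given
    Gaussian.\<close>
  define \<sigma> where "\<sigma> = sqrt (1 / (2 * k))"
  have \<sigma>: "\<sigma> > 0" "\<sigma>\<^sup>2 = 1 / (2 * k)"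
    using assms by (simp_all add: \<sigma>_def)
  have *: "exp (- k * (x - m)\<^sup>2) = sqrt (pi / k) * normal_density m \<sigma> x" for x
    unfolding normal_density_def \<sigma>(2) using assms by (simp add: mult.commute)
  have "has_bochner_integral lborel (normal_density m \<sigma>) 1"
    using \<sigma> by (simp add: has_bochner_integral_iff)
  then have "has_bochner_integral lborel (\<lambda>x. sqrt (pi / k) * normal_density m \<sigma> x) (sqrt (pi / k) * 1)"
    by (intro has_bochner_integral_mult_right) auto
  then show ?thesis by (simp only: * mult_1_right)
qed

text \<open>Truncation to [-n, n] and dominated convergence with majorant |f|. Only the difference
  of the end values is claimed to converge, which is what contour comparisons use.\<close>

lemma LIMSEQ_FTC_whole_line:
  fixes F f :: "real \<Rightarrow> complex"
  assumes F: "\<And>x. (F has_vector_derivative f x) (at x)"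
    and cont: "continuous_on UNIV f"
    and int: "integrable lborel f"
  shows "(\<lambda>n. F (real n) - F (- real n)) \<longlonglongrightarrow> (LINT x|lborel. f x)"
proof -
  have "(\<lambda>n. LINT x|lborel. indicator {- real n..real n} x *\<^sub>R f x) \<longlonglongrightarrow> (LINT x|lborel. f x)"
  proof (rule integral_dominated_convergence)
    show "integrable lborel (\<lambda>x. norm (f x))" using int by simp
    show "AE x in lborel. (\<lambda>n. indicator {- real n..real n} x *\<^sub>R f x) \<longlonglongrightarrow> f x"
    proof (rule AE_I2)
      fix x :: real
      obtain N :: nat where N: "\<bar>x\<bar> \<le> real N" using real_arch_simple by blast
      have "eventually (\<lambda>n. indicator {- real n..real n} x *\<^sub>R f x = f x) sequentially"
        unfolding eventually_sequentially
      proof (intro exI[of _ N] allI impI)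
        fix n assume "N \<le> n"
        then have "\<bar>x\<bar> \<le> real n" using N by linarith
        then show "indicator {- real n..real n} x *\<^sub>R f x = f x"
          by (auto simp: indicator_def)
      qed
      then show "(\<lambda>n. indicator {- real n..real n} x *\<^sub>R f x) \<longlonglongrightarrow> f x"
        by (rule tendsto_eventually)
    qed
  qed (use borel_measurable_integrable[OF int] in \<open>auto simp: indicator_def\<close>)
  moreover have "(LINT x|lborel. indicator {- real n..real n} x *\<^sub>R f x) = F (real n) - F (- real n)" for n
    by (rule integral_FTC_atLeastAtMost)
       (auto intro: has_vector_derivative_at_within F continuous_on_subset[OF cont])
  ultimately show ?thesis by simp
qed

text \<open>The phase has no factor 1/3, so \<open>airy s\<close> is the classical Airy function up
  to scaling: 2 pi 3^(-1/3) Ai(3^(-1/3) s).\<close>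

definition airy_integrand :: "real \<Rightarrow> complex \<Rightarrow> complex" where
  "airy_integrand s z = exp (\<i> * (z ^ 3 + of_real s * z))"

text \<open>On the real axis the integrand has modulus one; on the line Im z = 1 it decays like
  exp(-3 a^2), so the integral converges absolutely. By \<open>airy_shift\<close> every positive
  height gives the same value.\<close>

definition airy :: "real \<Rightarrow> complex" where
  "airy s = (LINT a|lborel. airy_integrand s (Complex a 1))"

lemma norm_airy_integrand:
  "norm (airy_integrand s (Complex a b)) = exp (- b * (3 * a\<^sup>2 - b\<^sup>2 + s))"
  by (simp add: airy_integrand_def power3_eq_cube power2_eq_square algebra_simps)

lemma continuous_on_airy_integrand [continuous_intros]:
  "continuous_on S f \<Longrightarrow> continuous_on S (\<lambda>x. airy_integrand s (f x))"
  unfolding airy_integrand_def by (intro continuous_intros)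

lemma integrable_airy_integrand:
  assumes "0 < \<delta>"
  shows "integrable lborel (\<lambda>a. airy_integrand s (Complex a \<delta>))"
proof (rule Bochner_Integration.integrable_bound)
  show "integrable lborel (\<lambda>a::real. exp (\<delta> * (\<delta>\<^sup>2 - s)) * exp (- (3 * \<delta>) * (a - 0)\<^sup>2))"
    using has_bochner_integral_gaussian[of "3 * \<delta>" 0] assms
    by (intro integrable_mult_right) (simp add: has_bochner_integral_iff)
  show "(\<lambda>a. airy_integrand s (Complex a \<delta>)) \<in> borel_measurable lborel"
    by (simp, intro borel_measurable_continuous_onI continuous_intros)
  show "AE a in lborel. norm (airy_integrand s (Complex a \<delta>))
      \<le> norm (exp (\<delta> * (\<delta>\<^sup>2 - s)) * exp (- (3 * \<delta>) * (a - 0)\<^sup>2))"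
    by (simp add: norm_airy_integrand mult_exp_exp) (simp add: algebra_simps)
qed

text \<open>The integrand is entire and so has a global primitive F. Contour deformations then
  reduce to comparing values of F at end points.\<close>

lemma airy_integrand_primitive:
  obtains F where "\<And>z. (F has_field_derivative airy_integrand s z) (at z)"
proof -
  have "airy_integrand s holomorphic_on UNIV"
    unfolding airy_integrand_def[abs_def] by (intro holomorphic_intros)
  then show thesis
    using holomorphic_convex_primitive'[of UNIV "airy_integrand s"] that by auto
qed

lemma primitive_vertical_bound:
  assumes F: "\<And>z. (F has_field_derivative airy_integrand s z) (at z)"
    and "0 < \<delta>" "\<delta> \<le> b" "b \<le> \<bar>R\<bar>" "0 \<le> 2 * R\<^sup>2 + s"
  shows "norm (F (Complex R \<delta>) - F (Complex R b)) \<le> \<bar>R\<bar> * exp (- \<delta> * (2 * R\<^sup>2 + s))"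
proof -
  define S where "S = {z. Re z = R \<and> \<delta> \<le> Im z \<and> Im z \<le> b}"
  have S: "S = ({z. Re z \<ge> R} \<inter> {z. Re z \<le> R}) \<inter> ({z. Im z \<ge> \<delta>} \<inter> {z. Im z \<le> b})"
    by (auto simp: S_def)
  have "norm (F (Complex R \<delta>) - F (Complex R b))
      \<le> exp (- \<delta> * (2 * R\<^sup>2 + s)) * norm (Complex R \<delta> - Complex R b)"
  proof (rule field_differentiable_bound[where S = S])
    show "convex S" unfolding S
      by (intro convex_Int convex_halfspace_Re_ge convex_halfspace_Re_le convex_halfspace_Im_ge convex_halfspace_Im_le)
    fix z assume z: "z \<in> S"
    show "(F has_field_derivative airy_integrand s z) (at z within S)"
      by (rule DERIV_subset[OF F]) simp
    have "(Im z)\<^sup>2 \<le> R\<^sup>2"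
      using z assms unfolding S_def by (intro abs_le_square_iff[THEN iffD1]) auto
    then have "\<delta> * (2 * R\<^sup>2 + s) \<le> Im z * (3 * R\<^sup>2 - (Im z)\<^sup>2 + s)"
      using z assms unfolding S_def by (intro mult_mono) auto
    moreover have "z = Complex R (Im z)" using z by (simp add: S_def complex_eq_iff)
    ultimately show "norm (airy_integrand s z) \<le> exp (- \<delta> * (2 * R\<^sup>2 + s))"
      by (metis exp_le_cancel_iff minus_mult_left neg_le_iff_le norm_airy_integrand)
  qed (use assms in \<open>auto simp: S_def\<close>)
  also have "norm (Complex R \<delta> - Complex R b) = b - \<delta>"
    using assms by (simp add: cmod_def)
  also have "exp (- \<delta> * (2 * R\<^sup>2 + s)) * (b - \<delta>) \<le> exp (- \<delta> * (2 * R\<^sup>2 + s)) * \<bar>R\<bar>"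
    using assms by (intro mult_left_mono) auto
  finally show ?thesis by (simp add: mult.commute)
qed

lemma vertical_bound_tendsto:
  fixes \<delta> s :: real
  assumes "0 < \<delta>"
  shows "(\<lambda>n. \<bar>real n\<bar> * exp (- \<delta> * (2 * (real n)\<^sup>2 + s))) \<longlonglongrightarrow> 0"
  using assms by real_asymp

lemma eventually_le_real_and_nonneg_square:
  fixes s b :: real
  shows "eventually (\<lambda>n. b \<le> real n \<and> 0 \<le> 2 * (real n)\<^sup>2 + s) sequentially"
proof -
  have "eventually (\<lambda>n. b \<le> real n) sequentially" "eventually (\<lambda>n. 0 \<le> 2 * (real n)\<^sup>2 + s) sequentially"
    by real_asymp+
  then show ?thesis by eventually_elim simp
qed

lemma primitive_horizontal_limit:
  assumes F: "\<And>z. (F has_field_derivative airy_integrand s z) (at z)" and "0 < \<delta>"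
  shows "(\<lambda>n. F (Complex (real n) \<delta>) - F (Complex (- real n) \<delta>))
    \<longlonglongrightarrow> (LINT a|lborel. airy_integrand s (Complex a \<delta>))"
proof (rule LIMSEQ_FTC_whole_line[where F = "\<lambda>x. F (Complex x \<delta>)"])
  fix x :: real
  have "((\<lambda>x. Complex x \<delta>) has_vector_derivative 1) (at x)"
    unfolding Complex_eq by (auto intro!: derivative_eq_intros)
  from field_vector_diff_chain_at[OF this F]
  show "((\<lambda>x. F (Complex x \<delta>)) has_vector_derivative airy_integrand s (Complex x \<delta>)) (at x)"
    by (simp add: o_def)
qed (auto intro!: continuous_intros integrable_airy_integrand assms)

text \<open>Cauchy's theorem for the rectangle with corners at real parts -n and n and heights
  \<delta> and b: the vertical sides vanish as n grows, so the horizontal integrals agree.\<close>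

lemma airy_shift_le:
  assumes "0 < \<delta>" "\<delta> \<le> b"
  shows "(LINT a|lborel. airy_integrand s (Complex a \<delta>)) = (LINT a|lborel. airy_integrand s (Complex a b))"
proof -
  obtain F where F: "\<And>z. (F has_field_derivative airy_integrand s z) (at z)"
    using airy_integrand_primitive by metis
  have vert: "(\<lambda>n. F (Complex (\<sigma> * real n) \<delta>) - F (Complex (\<sigma> * real n) b)) \<longlonglongrightarrow> 0" if "\<bar>\<sigma>\<bar> = 1" for \<sigma> :: real
  proof (rule Lim_null_comparison[OF _ vertical_bound_tendsto[OF assms(1), of s]])
    have \<sigma>: "\<sigma>\<^sup>2 = 1" using that by (metis abs_1 power2_abs power_one)
    show "\<forall>\<^sub>F n in sequentially. norm (F (Complex (\<sigma> * real n) \<delta>) - F (Complex (\<sigma> * real n) b))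
        \<le> \<bar>real n\<bar> * exp (- \<delta> * (2 * (real n)\<^sup>2 + s))"
      using eventually_le_real_and_nonneg_square[of b s]
    proof eventually_elim
      case (elim n)
      show ?case
        using primitive_vertical_bound[OF F assms, of "\<sigma> * real n"] elim that \<sigma>
        by (simp add: abs_mult power_mult_distrib)
    qed
  qed
  have "(\<lambda>n. (F (Complex (real n) \<delta>) - F (Complex (- real n) \<delta>)) -
      (F (Complex (real n) \<delta>) - F (Complex (real n) b)) +
      (F (Complex (- real n) \<delta>) - F (Complex (- real n) b)))
    \<longlonglongrightarrow> (LINT a|lborel. airy_integrand s (Complex a \<delta>)) - 0 + 0"
    using vert[of 1] vert[of "-1"] primitive_horizontal_limit[OF F assms(1)]
    by (intro tendsto_intros) auto
  then have "(\<lambda>n. F (Complex (real n) b) - F (Complex (- real n) b))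
      \<longlonglongrightarrow> (LINT a|lborel. airy_integrand s (Complex a \<delta>))"
    by simp
  moreover have "(\<lambda>n. F (Complex (real n) b) - F (Complex (- real n) b))
      \<longlonglongrightarrow> (LINT a|lborel. airy_integrand s (Complex a b))"
    using assms by (intro primitive_horizontal_limit F) auto
  ultimately show ?thesis by (rule LIMSEQ_unique)
qed

lemma airy_shift:
  assumes "0 < \<delta>"
  shows "(LINT a|lborel. airy_integrand s (Complex a \<delta>)) = airy s"
  unfolding airy_def using airy_shift_le[of \<delta> 1] airy_shift_le[of 1 \<delta>] assms by (cases "\<delta> \<le> 1") auto

section \<open>Size of the Airy function\<close>

lemma norm_airy_le_exp: "norm (airy s) \<le> exp 1 * sqrt (pi / 3) * exp (- s)"
proof -
  have "norm (airy s) \<le> (LINT a|lborel. norm (airy_integrand s (Complex a 1)))"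
    unfolding airy_def by (rule integral_norm_bound)
  also have "(\<lambda>a. norm (airy_integrand s (Complex a 1))) = (\<lambda>a. exp 1 * exp (- s) * exp (- 3 * (a - 0)\<^sup>2))"
    by (simp add: norm_airy_integrand mult_exp_exp fun_eq_iff)
  also have "(LINT a|lborel. exp 1 * exp (- s) * exp (- 3 * (a - 0)\<^sup>2)) = exp 1 * exp (- s) * sqrt (pi / 3)"
    using has_bochner_integral_gaussian[of 3 0] by (simp add: has_bochner_integral_iff)
  finally show ?thesis by (simp add: mult_ac)
qed

text \<open>For \<open>s < 0\<close> the contour is deformed to \<open>Im z = \<bar>Re z\<bar> - x0\<close>, which crosses the
  real axis at the stationary points \<open>\<plusminus>x0\<close> of the phase; along it the integrand is dominated by
  a Gaussian of width \<open>x0 powr (-1/2)\<close> about each of them.\<close>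

lemma primitive_diagonal_bound:
  assumes F: "\<And>z. (F has_field_derivative airy_integrand s z) (at z)"
    and x0: "0 < x0" "3 * x0\<^sup>2 = - s" and \<sigma>: "\<bar>\<sigma>\<bar> = 1" and "0 \<le> R"
  shows "norm (F (Complex (\<sigma> * R) (R - x0)) - F (Complex 0 (- x0))) \<le> sqrt 2 * sqrt (pi / (4 * x0))"
proof -
  \<comment> \<open>The integrand along the half diagonal, multiplied by the tangent vector \<sigma>
    + i of the parametrisation; \<sigma> selects the right or left branch.\<close>
  define g where "g x = airy_integrand s (Complex (\<sigma> * x) (x - x0)) * Complex \<sigma> 1" for x
  have \<sigma>2: "\<sigma>\<^sup>2 = 1" using \<sigma> by (metis abs_1 power2_abs power_one)
  have contg: "continuous_on S g" for S unfolding g_def by (intro continuous_intros)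
  have der: "((\<lambda>x. F (Complex (\<sigma> * x) (x - x0))) has_vector_derivative g x) (at x)" for x
  proof -
    have "((\<lambda>x. Complex (\<sigma> * x) (x - x0)) has_vector_derivative Complex \<sigma> 1) (at x)"
      unfolding Complex_eq by (auto intro!: derivative_eq_intros)
    from field_vector_diff_chain_at[OF this F] show ?thesis
      by (simp add: o_def g_def mult.commute)
  qed
  have "(LINT x|lborel. indicator {0..R} x *\<^sub>R g x) = F (Complex (\<sigma> * R) (R - x0)) - F (Complex (\<sigma> * 0) (0 - x0))"
    by (rule integral_FTC_atLeastAtMost) (auto intro: assms has_vector_derivative_at_within der contg)
  then have "norm (F (Complex (\<sigma> * R) (R - x0)) - F (Complex 0 (- x0)))
      = norm (LINT x|lborel. indicator {0..R} x *\<^sub>R g x)" by simp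
  also have "\<dots> \<le> (LINT x|lborel. sqrt 2 * exp (- (4 * x0) * (x - x0)\<^sup>2))"
  proof (rule Bochner_Integration.integral_norm_bound_integral)
    show "integrable lborel (\<lambda>x. indicator {0..R} x *\<^sub>R g x)"
      using borel_integrable_atLeastAtMost'[OF contg] by (simp add: set_integrable_def)
    show "integrable lborel (\<lambda>x. sqrt 2 * exp (- (4 * x0) * (x - x0)\<^sup>2))"
      using has_bochner_integral_gaussian[of "4 * x0" x0] x0
      by (intro integrable_mult_right) (simp add: has_bochner_integral_iff)
    fix x :: real
    show "norm (indicator {0..R} x *\<^sub>R g x) \<le> sqrt 2 * exp (- (4 * x0) * (x - x0)\<^sup>2)"
    proof (cases "x \<in> {0..R}")
      case True
      \<comment> \<open>Because s = -3 x0^2, the second factor equals (x - x0)(2x + 4 x0): the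
        stationary point contributes a second zero, and x \<ge> 0 leaves Gaussian decay with rate 4
        x0.\<close>
      have "(x - x0) * (3 * (\<sigma> * x)\<^sup>2 - (x - x0)\<^sup>2 + s) = (x - x0)\<^sup>2 * (2 * x + 4 * x0)"
        using x0(2) by (simp add: power_mult_distrib \<sigma>2) algebra
      also have "\<dots> \<ge> (x - x0)\<^sup>2 * (4 * x0)"
        using True by (intro mult_left_mono) auto
      finally have "- (x - x0) * (3 * (\<sigma> * x)\<^sup>2 - (x - x0)\<^sup>2 + s) \<le> - (4 * x0) * (x - x0)\<^sup>2"
        by (simp only: mult.commute mult_minus_right neg_le_iff_le)
      then have "norm (airy_integrand s (Complex (\<sigma> * x) (x - x0))) \<le> exp (- (4 * x0) * (x - x0)\<^sup>2)"
        unfolding norm_airy_integrand by simp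
      moreover have "norm (Complex \<sigma> 1) = sqrt 2" by (simp add: cmod_def \<sigma>2)
      ultimately show ?thesis using True by (simp add: g_def norm_mult mult.commute)
    qed auto
  qed
  also have "\<dots> = sqrt 2 * sqrt (pi / (4 * x0))"
    using has_bochner_integral_gaussian[of "4 * x0" x0] x0 by (simp add: has_bochner_integral_iff)
  finally show ?thesis .
qed

text \<open>The segment from -n + i to n + i is replaced by five points joined by four pieces: up to
  height n - x0, down a diagonal to -i x0, up the other diagonal, and back down to height 1. Each
  diagonal costs one Gaussian integral, and the vertical pieces vanish in the limit.\<close>

lemma norm_airy_le_saddle:
  assumes x0: "0 < x0" "3 * x0\<^sup>2 = - s"
  shows "norm (airy s) \<le> 2 * (sqrt 2 * sqrt (pi / (4 * x0)))"
proof -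
  obtain F where F: "\<And>z. (F has_field_derivative airy_integrand s z) (at z)"
    using airy_integrand_primitive by metis
  define c where "c = sqrt 2 * sqrt (pi / (4 * x0))"
  define e where "e n = \<bar>real n\<bar> * exp (- 1 * (2 * (real n)\<^sup>2 + s))" for n
  have "eventually (\<lambda>n. norm (F (Complex (real n) 1) - F (Complex (- real n) 1)) \<le> 2 * c + 2 * e n) sequentially"
    \<comment> \<open>The threshold x0 + 1 ensures that the diagonals end at height n - x0 \<ge> 1,
      above the horizontal line.\<close>
    using eventually_le_real_and_nonneg_square[of "x0 + 1" s]
  proof eventually_elim
    case (elim n)
    have v: "norm (F (Complex (\<sigma> * real n) 1) - F (Complex (\<sigma> * real n) (real n - x0))) \<le> e n"
      if "\<sigma> \<in> {1, -1}" for \<sigma>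
      using primitive_vertical_bound[OF F, of 1 "real n - x0" "\<sigma> * real n"] elim that x0
      by (auto simp: e_def)
    have d: "norm (F (Complex (\<sigma> * real n) (real n - x0)) - F (Complex 0 (- x0))) \<le> c"
      if "\<sigma> \<in> {1, -1}" for \<sigma>
      using primitive_diagonal_bound[OF F x0, of \<sigma> "real n"] that
      by (auto simp: c_def)
    show ?case
      using v[of 1] v[of "-1"] d[of 1] d[of "-1"] by (simp add: norm_minus_commute) norm
  qed
  moreover have "(\<lambda>n. norm (F (Complex (real n) 1) - F (Complex (- real n) 1))) \<longlonglongrightarrow> norm (airy s)"
    unfolding airy_def by (intro tendsto_norm primitive_horizontal_limit F) simp
  moreover have "e \<longlonglongrightarrow> 0" 
    using vertical_bound_tendsto[of 1 s] unfolding e_def[abs_def] by simp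
  then have "(\<lambda>n. 2 * c + 2 * e n) \<longlonglongrightarrow> 2 * c + 2 * 0"
    by (intro tendsto_intros)
  ultimately have "norm (airy s) \<le> 2 * c + 2 * 0"
    by (intro tendsto_le[of sequentially]) auto
  then show ?thesis by (simp add: c_def)
qed

lemma airy_bounds:
  obtains C where "0 < C" "\<And>s. norm (airy s) \<le> C" "\<And>s. norm (airy s) \<le> C * exp (- s)"
    "\<And>s. s < 0 \<Longrightarrow> norm (airy s) \<le> C * \<bar>s\<bar> powr (- 1 / 4)"
proof -
  define C1 where "C1 = exp 1 * sqrt (pi / 3)"
  define C2 where "C2 = 2 * (sqrt 2 * sqrt (pi / 4 * sqrt 3))"
  have pos: "0 < C1" "0 < C2" by (auto simp: C1_def C2_def)
  have decay: "norm (airy s) \<le> C2 * \<bar>s\<bar> powr (- 1 / 4)" if "s < 0" for s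
  proof -
    \<comment> \<open>The stationary point is x0 = sqrt(|s|/3); the square root of 1/x0 produces the
      power -1/4 of |s|.\<close>
    have "norm (airy s) \<le> 2 * (sqrt 2 * sqrt (pi / (4 * sqrt (\<bar>s\<bar> / 3))))"
      using that by (intro norm_airy_le_saddle) auto
    also have "pi / (4 * sqrt (\<bar>s\<bar> / 3)) = pi / 4 * sqrt 3 / sqrt \<bar>s\<bar>"
      by (simp add: real_sqrt_divide)
    also have "sqrt (pi / 4 * sqrt 3 / sqrt \<bar>s\<bar>) = sqrt (pi / 4 * sqrt 3) / sqrt (sqrt \<bar>s\<bar>)"
      by (rule real_sqrt_divide)
    also have "sqrt (sqrt \<bar>s\<bar>) = \<bar>s\<bar> powr (1 / 4)"
      by (simp add: powr_half_sqrt[symmetric] powr_powr)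
    finally show ?thesis by (simp add: C2_def powr_minus_divide)
  qed
  \<comment> \<open>For s < -1 the power bound is at most its constant; for s \<ge> -1 the factor
    exp(-s) is at most e.\<close>
  have bounded: "norm (airy s) \<le> C1 * exp 1 + C2" for s
  proof (cases "s < -1")
    case True
    have "\<bar>s\<bar> powr (- 1 / 4) \<le> 1" 
      using True powr_mono[of "-1/4" 0 "\<bar>s\<bar>"] by auto
    then have "C2 * \<bar>s\<bar> powr (- 1 / 4) \<le> C2 * 1" using pos by (intro mult_left_mono) auto
    then show ?thesis using decay[of s] True pos by (smt (verit) exp_gt_zero mult_pos_pos)
  next
    case False
    then have "C1 * exp (- s) \<le> C1 * exp 1" using pos by (intro mult_left_mono) auto
    then show ?thesis using norm_airy_le_exp[of s] pos unfolding C1_def[symmetric] by linarith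
  qed
  define C where "C = C1 * exp 1 + C1 + C2"
  have C: "C1 * exp 1 + C2 \<le> C" "C1 \<le> C" "C2 \<le> C"  "0 < C"
    using pos by (auto simp: C_def add_pos_pos)
  show thesis
  proof (rule that[of C])
    show "norm (airy s) \<le> C" for s using bounded[of s] C by linarith
    show "norm (airy s) \<le> C * exp (- s)" for s
      by (rule order_trans[OF norm_airy_le_exp[of s, folded C1_def] mult_right_mono[OF C(2)]]) simp
    show "norm (airy s) \<le> C * \<bar>s\<bar> powr (- 1 / 4)" if "s < 0" for s
      using decay[OF that] mult_right_mono[OF C(3), of "\<bar>s\<bar> powr (- 1 / 4)"] by simp
  qed (use C in simp)
qed

subsection \<open>Integration over the plane\<close>

lemma integrable_inverse_one_plus_square: "integrable lborel (\<lambda>x::real. inverse (1 + x\<^sup>2))"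
  using integrable_inverse_1_plus_square by (simp add: set_integrable_def)

lemma integrable_lborel_prod:
  fixes f :: "'a::euclidean_space \<Rightarrow> 'c::{real_normed_field, banach, second_countable_topology}"
    and g :: "'b::euclidean_space \<Rightarrow> 'c"
  assumes "integrable lborel f" "integrable lborel g"
  shows "integrable lborel (\<lambda>p. f (fst p) * g (snd p))"
    and "(LINT p|lborel. f (fst p) * g (snd p)) = (LINT x|lborel. f x) * (LINT y|lborel. g y)"
proof -
  have [measurable]: "f \<in> borel_measurable borel" "g \<in> borel_measurable borel"
    using assms[THEN borel_measurable_integrable] by auto
  have int: "integrable (lborel \<Otimes>\<^sub>M lborel) (\<lambda>p. f (fst p) * g (snd p))"
  proof (rule lborel_pair.Fubini_integrable)
    show "integrable lborel (\<lambda>x. LINT y|lborel. norm (f (fst (x, y)) * g (snd (x, y))))"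
      using assms by (simp add: norm_mult)
    show "AE x in lborel. integrable lborel (\<lambda>y. f (fst (x, y)) * g (snd (x, y)))"
      using assms by simp
  qed measurable
  then show "integrable lborel (\<lambda>p. f (fst p) * g (snd p))" by (simp add: lborel_prod)
  show "(LINT p|lborel. f (fst p) * g (snd p)) = (LINT x|lborel. f x) * (LINT y|lborel. g y)"
    using lborel_pair.integral_fst'[OF int] by (simp add: lborel_prod)
qed

lemma lborel_integral_fst:
  fixes f :: "'a::euclidean_space \<times> 'b::euclidean_space \<Rightarrow> 'c::{banach, second_countable_topology}"
  assumes "integrable lborel f"
  shows "(LINT x|lborel. LINT y|lborel. f (x, y)) = (LINT p|lborel. f p)"
  using lborel_pair.integral_fst'[of f] assms by (simp add: lborel_prod)

lemma lborel_integral_snd: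
  fixes f :: "'a::euclidean_space \<times> 'b::euclidean_space \<Rightarrow> 'c::{banach, second_countable_topology}"
  assumes "integrable lborel f"
  shows "(LINT y|lborel. LINT x|lborel. f (x, y)) = (LINT p|lborel. f p)"
  using lborel_pair.integral_snd[of "\<lambda>x y. f (x, y)"] assms by (simp add: lborel_prod)

text \<open>The product weight allows domination by a tensor product of two integrable functions
  1/(1 + x^2).\<close>

lemma integrable_inverse_square_decay:
  fixes f :: "real \<times> real \<Rightarrow> complex"
  assumes [measurable]: "f \<in> borel_measurable borel"
    and bound: "\<And>p. norm (f p) * ((1 + (fst p)\<^sup>2) * (1 + (snd p)\<^sup>2)) \<le> B"
  shows "integrable lborel f"
proof (rule Bochner_Integration.integrable_bound)
  show "integrable lborel (\<lambda>p::real \<times> real. B * (inverse (1 + (fst p)\<^sup>2) * inverse (1 + (snd p)\<^sup>2)))"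
    by (intro integrable_mult_right integrable_lborel_prod integrable_inverse_one_plus_square)
  show "AE p in lborel. norm (f p) \<le> norm (B * (inverse (1 + (fst p)\<^sup>2) * inverse (1 + (snd p)\<^sup>2)))"
  proof (rule AE_I2)
    fix p :: "real \<times> real"
    have pos: "0 < (1 + (fst p)\<^sup>2) * (1 + (snd p)\<^sup>2)"
      by (intro mult_pos_pos add_pos_nonneg) auto
    have "norm (f p) \<le> B / ((1 + (fst p)\<^sup>2) * (1 + (snd p)\<^sup>2))"
      using bound[of p] pos by (subst pos_le_divide_eq) auto
    also have "\<dots> = B * (inverse (1 + (fst p)\<^sup>2) * inverse (1 + (snd p)\<^sup>2))"
      by (simp add: field_simps)
    finally show "norm (f p) \<le> norm (B * (inverse (1 + (fst p)\<^sup>2) * inverse (1 + (snd p)\<^sup>2)))"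
      by simp
  qed
qed simp

section \<open>A linear change of variables in the plane, with Jacobian k^2 sqrt(3)/2\<close>

definition rot :: "real \<Rightarrow> real \<times> real \<Rightarrow> real \<times> real" where
  "rot k p = (k * (fst p + snd p) / 2, k * sqrt 3 * (fst p - snd p) / 2)"

lemma measurable_rot [measurable]: "rot k \<in> borel_measurable borel"
  unfolding rot_def[abs_def] by (intro borel_measurable_continuous_onI continuous_intros) simp_all

text \<open>The map is undone by two one-dimensional substitutions, a = 2x/k - b and then b = x/k -
  y/(sqrt(3) k), with the order of integration exchanged in between. Their factors 2/k and
  1/(sqrt(3) k) multiply to the reciprocal of the Jacobian.\<close>

lemma nn_integral_rot:
  assumes k: "0 < k" and f [measurable]: "f \<in> borel_measurable borel"
  shows "(\<integral>\<^sup>+p. f p \<partial>lborel) = ennreal (k\<^sup>2 * sqrt 3 / 2) * (\<integral>\<^sup>+p. f (rot k p) \<partial>lborel)"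
proof -
  have rot_affine: "rot k (2 * x / k - b, b) = (x, sqrt 3 * (x - k * b))" for x b
    using k by (simp add: rot_def distrib_left right_diff_distrib diff_divide_distrib)
  have 1: "(\<integral>\<^sup>+a. f (rot k (a, b)) \<partial>lborel) = ennreal (2 / k) * (\<integral>\<^sup>+x. f (x, sqrt 3 * (x - k * b)) \<partial>lborel)" for b
    using k by (subst nn_integral_real_affine[of _ "2 / k" "- b"]) (simp_all add: rot_affine)
  have 2: "(\<integral>\<^sup>+b. f (x, sqrt 3 * (x - k * b)) \<partial>lborel) = ennreal (1 / (sqrt 3 * k)) * (\<integral>\<^sup>+y. f (x, y) \<partial>lborel)" for x
    using k by (subst nn_integral_real_affine[of _ "- 1 / (sqrt 3 * k)" "x / k"])
      (auto simp: field_simps intro!: nn_integral_cong arg_cong[of _ _ f])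
  have "(\<integral>\<^sup>+p. f (rot k p) \<partial>lborel) = (\<integral>\<^sup>+b. \<integral>\<^sup>+a. f (rot k (a, b)) \<partial>lborel \<partial>lborel)"
    by (subst lborel_pair.nn_integral_snd) (simp_all add: lborel_prod)
  also have "\<dots> = (\<integral>\<^sup>+b. ennreal (2 / k) * (\<integral>\<^sup>+x. f (x, sqrt 3 * (x - k * b)) \<partial>lborel) \<partial>lborel)"
    by (simp add: 1)
  also have "\<dots> = ennreal (2 / k) * (\<integral>\<^sup>+b. \<integral>\<^sup>+x. f (x, sqrt 3 * (x - k * b)) \<partial>lborel \<partial>lborel)"
    by (intro nn_integral_cmult) measurable
  also have "\<dots> = ennreal (2 / k) * (\<integral>\<^sup>+x. \<integral>\<^sup>+b. f (x, sqrt 3 * (x - k * b)) \<partial>lborel \<partial>lborel)"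
    by (subst lborel_pair.Fubini') simp_all
  also have "\<dots> = ennreal (2 / k) * (ennreal (1 / (sqrt 3 * k)) * (\<integral>\<^sup>+x. \<integral>\<^sup>+y. f (x, y) \<partial>lborel \<partial>lborel))"
    by (simp add: 2 nn_integral_cmult)
  also have "(\<integral>\<^sup>+x. \<integral>\<^sup>+y. f (x, y) \<partial>lborel \<partial>lborel) = (\<integral>\<^sup>+p. f p \<partial>lborel)"
    by (subst lborel.nn_integral_fst) (simp_all add: lborel_prod)
  finally have *: "(\<integral>\<^sup>+p. f (rot k p) \<partial>lborel)
      = ennreal (2 / k) * (ennreal (1 / (sqrt 3 * k)) * (\<integral>\<^sup>+p. f p \<partial>lborel))" .
  have collapse: "ennreal a * (ennreal b * (ennreal c * X)) = ennreal (a * (b * c)) * X"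
    if "0 \<le> a" "0 \<le> b" "0 \<le> c" for a b c X
    using that by (simp add: ennreal_mult mult.assoc)
  have "k\<^sup>2 * sqrt 3 / 2 * (2 / k * (1 / (sqrt 3 * k))) = 1"
    using k by (simp add: field_simps power2_eq_square)
  then show ?thesis using k unfolding * by (subst collapse) simp_all
qed

text \<open>Writing Lebesgue measure as a scaled image measure transfers the substitution rule from
  nonnegative to complex integrands.\<close>

lemma lborel_rot:
  assumes "0 < k"
  shows "lborel = density (distr lborel borel (rot k)) (\<lambda>_. ennreal (k\<^sup>2 * sqrt 3 / 2))"
proof (rule measure_eqI)
  fix X :: "(real \<times> real) set" assume "X \<in> sets lborel"
  then have [measurable]: "X \<in> sets borel" by simp
  have "emeasure lborel X = (\<integral>\<^sup>+p. indicator X p \<partial>lborel)" by simp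
  also have "\<dots> = ennreal (k\<^sup>2 * sqrt 3 / 2) * (\<integral>\<^sup>+p. indicator X (rot k p) \<partial>lborel)"
    by (rule nn_integral_rot[OF assms]) simp
  also have "(\<integral>\<^sup>+p. indicator X (rot k p) \<partial>lborel) = emeasure (distr lborel borel (rot k)) X"
    by (subst nn_integral_distr[of _ _ borel, symmetric]) simp_all
  also have "ennreal (k\<^sup>2 * sqrt 3 / 2) * \<dots> = emeasure (density (distr lborel borel (rot k)) (\<lambda>_. ennreal (k\<^sup>2 * sqrt 3 / 2))) X"
    by (simp add: emeasure_density nn_integral_cmult)
  finally show "emeasure lborel X
      = emeasure (density (distr lborel borel (rot k)) (\<lambda>_. ennreal (k\<^sup>2 * sqrt 3 / 2))) X" .
qed simp

lemma lborel_integral_rot: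
  fixes f :: "real \<times> real \<Rightarrow> complex"
  assumes k: "0 < k" and [measurable]: "f \<in> borel_measurable borel"
  shows "(LINT p|lborel. f p) = of_real (k\<^sup>2 * sqrt 3 / 2) * (LINT p|lborel. f (rot k p))"
    and "integrable lborel f \<Longrightarrow> integrable lborel (\<lambda>p. f (rot k p))"
proof -
  show "(LINT p|lborel. f p) = of_real (k\<^sup>2 * sqrt 3 / 2) * (LINT p|lborel. f (rot k p))"
    using k by (subst lborel_rot[OF k]) (simp add: integral_density integral_distr scaleR_conv_of_real)
  show "integrable lborel (\<lambda>p. f (rot k p))" if "integrable lborel f"
  proof -
    define c where "c = k\<^sup>2 * sqrt 3 / 2"
    have "c > 0" using k by (simp add: c_def)
    moreover have "integrable (density (distr lborel borel (rot k)) (\<lambda>_. ennreal c)) f"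
      using that lborel_rot[OF k, folded c_def] by simp
    ultimately have "integrable lborel (\<lambda>p. c *\<^sub>R f (rot k p))"
      by (simp add: integrable_density integrable_distr_eq)
    from integrable_scaleR_right[OF this, of "1 / c"] show ?thesis
      using \<open>c > 0\<close> by simp
  qed
qed

subsection \<open>Fourier transforms of Schwartz functions\<close>

text \<open>Each factor is at most (1 + |p|)^2. This turns radial decay of order 4 into the product
  weight used for integrability.\<close>

lemma one_plus_square_mult_le:
  fixes p :: "real \<times> real"
  shows "(1 + (fst p)\<^sup>2) * (1 + (snd p)\<^sup>2) \<le> (1 + norm p) ^ 4"
proof -
  have *: "1 + c\<^sup>2 \<le> (1 + norm p)\<^sup>2" if "\<bar>c\<bar> \<le> norm p" for c :: real
  proof -
    have "c\<^sup>2 \<le> (norm p)\<^sup>2" using that by (intro abs_le_square_iff[THEN iffD1]) simp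
    then show ?thesis by (simp add: power2_sum add_increasing2)
  qed
  have "\<bar>fst p\<bar> \<le> norm p" "\<bar>snd p\<bar> \<le> norm p"
    using norm_fst_le[of "fst p" "snd p"] norm_snd_le[of "snd p" "fst p"] by simp_all
  then have "(1 + (fst p)\<^sup>2) * (1 + (snd p)\<^sup>2) \<le> (1 + norm p)\<^sup>2 * (1 + norm p)\<^sup>2"
    by (intro mult_mono *) auto
  also have "\<dots> = (1 + norm p) ^ 4" by (simp flip: power_add)
  finally show ?thesis .
qed

lemma borel_measurable_cis [measurable]: "cis \<in> borel_measurable borel"
  by (intro borel_measurable_continuous_onI continuous_intros)

lemma vector_derivative_lipschitz:
  fixes f :: "real \<Rightarrow> 'a::real_normed_vector"
  assumes "\<And>x. (f has_vector_derivative f' x) (at x)" "\<And>x. norm (f' x) \<le> B"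
  shows "norm (f x - f y) \<le> B * \<bar>x - y\<bar>"
proof -
  have "norm (f x - f y) \<le> B * norm (x - y)"
  proof (rule differentiable_bound[of UNIV f "\<lambda>x h. h *\<^sub>R f' x"])
    show "(f has_derivative (\<lambda>h. h *\<^sub>R f' x)) (at x within UNIV)" for x
      using assms(1)[of x] by (simp add: has_vector_derivative_def)
    show "onorm (\<lambda>h. h *\<^sub>R f' x) \<le> B" for x
    proof (rule onorm_le)
      show "norm (h *\<^sub>R f' x) \<le> B * norm h" for h :: real
        using mult_left_mono[OF assms(2)[of x], of "\<bar>h\<bar>"] by (simp add: mult.commute)
    qed
  qed auto
  then show ?thesis by simp
qed

text \<open>The decay 1/(1 + x^2) removes the boundary terms. The offset \<open>b\<close> carries
  the phase of the other, frozen variable when this is applied in the plane.\<close>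

lemma oscillatory_integration_by_parts:
  fixes f f' :: "real \<Rightarrow> complex"
  assumes f: "\<And>x. (f has_vector_derivative f' x) (at x)"
    and cont: "continuous_on UNIV f'"
    and bound: "\<And>x. (1 + x\<^sup>2) * norm (f x) \<le> B" "\<And>x. (1 + x\<^sup>2) * norm (f' x) \<le> B"
  shows "(LINT x|lborel. cis (x * a + b) * f' x) = - \<i> * of_real a * (LINT x|lborel. cis (x * a + b) * f x)"
proof -
  have contf: "continuous_on UNIV f"
    using f by (meson continuous_at_imp_continuous_on has_vector_derivative_continuous)
  have decay: "norm c \<le> B * inverse (1 + x\<^sup>2)" if "(1 + x\<^sup>2) * norm c \<le> B" for x :: real and c :: complex
  proof -
    have "0 < 1 + x\<^sup>2" by (simp add: add_pos_nonneg)
    then show ?thesis using that by (simp add: field_simps)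
  qed
  have int: "integrable lborel (\<lambda>x. cis (x * a + b) * g x)"
    if "continuous_on UNIV g" "\<And>x. (1 + x\<^sup>2) * norm (g x) \<le> B" for g :: "real \<Rightarrow> complex"
  proof (rule Bochner_Integration.integrable_bound)
    show "integrable lborel (\<lambda>x::real. B * inverse (1 + x\<^sup>2))"
      by (intro integrable_mult_right integrable_inverse_one_plus_square)
    show "(\<lambda>x. cis (x * a + b) * g x) \<in> borel_measurable lborel"
      using that(1) by (simp, intro borel_measurable_continuous_onI continuous_intros)
    show "AE x in lborel. norm (cis (x * a + b) * g x) \<le> norm (B * inverse (1 + x\<^sup>2))"
      using decay[OF that(2)] by (intro AE_I2) (simp add: norm_mult, smt (verit))
  qed
  define F where "F x = cis (x * a + b) * f x" for x
  \<comment> \<open>The derivative of F by the product rule; its integral over the line is the limit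
    of the boundary terms, namely 0.\<close>
  define G where "G x = cis (x * a + b) * f' x + \<i> * of_real a * F x" for x
  have intF: "integrable lborel F" unfolding F_def by (intro int contf bound)
  have intf': "integrable lborel (\<lambda>x. cis (x * a + b) * f' x)" by (intro int cont bound)
  have "(\<lambda>n. F (real n) - F (- real n)) \<longlonglongrightarrow> (LINT x|lborel. G x)"
  proof (rule LIMSEQ_FTC_whole_line)
    fix x
    have lin: "(\<lambda>x. \<i> * of_real (x * a + b)) = (\<lambda>x. of_real x * (\<i> * of_real a) + \<i> * of_real b)"
      by (simp add: algebra_simps fun_eq_iff)
    have "((\<lambda>x. \<i> * of_real (x * a + b)) has_vector_derivative \<i> * of_real a) (at x)"
      unfolding lin by (auto intro!: derivative_eq_intros)
    from field_vector_diff_chain_at[OF this DERIV_exp]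
    have "((\<lambda>x. cis (x * a + b)) has_vector_derivative (\<i> * of_real a * cis (x * a + b))) (at x)"
      unfolding cis_conv_exp by (simp add: o_def)
    from has_vector_derivative_mult[OF this f[of x]]
    show "(F has_vector_derivative G x) (at x)"
      unfolding F_def[abs_def] G_def by (simp add: mult_ac add.commute)
    show "continuous_on UNIV G"
      unfolding G_def[abs_def] F_def by (intro continuous_intros cont contf)
    show "integrable lborel G"
      unfolding G_def[abs_def] by (intro Bochner_Integration.integrable_add intf' integrable_mult_right intF)
  qed
  moreover have "(\<lambda>n. F (real n) - F (- real n)) \<longlonglongrightarrow> 0"
  proof (rule Lim_null_comparison)
    have "norm (F x) \<le> B * inverse (1 + x\<^sup>2)" for x
      using decay[OF bound(1)[of x]] by (simp add: F_def norm_mult)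
    then have "norm (F (real n) - F (- real n)) \<le> 2 * (B * inverse (1 + (real n)\<^sup>2))" for n
      by (smt (verit) norm_triangle_ineq4 power2_minus)
    then show "\<forall>\<^sub>F n in sequentially. norm (F (real n) - F (- real n)) \<le> 2 * (B * inverse (1 + (real n)\<^sup>2))"
      by simp
    show "(\<lambda>n. 2 * (B * inverse (1 + (real n)\<^sup>2))) \<longlonglongrightarrow> 0"
      by real_asymp
  qed
  ultimately have "0 = (LINT x|lborel. G x)" by (rule LIMSEQ_unique[rotated])
  also have "(LINT x|lborel. G x)
      = (LINT x|lborel. cis (x * a + b) * f' x) + \<i> * of_real a * (LINT x|lborel. F x)"
    unfolding G_def
    by (subst Bochner_Integration.integral_add) (auto intro: intF intf')
  finally show ?thesis
    unfolding F_def by (simp add: add_eq_0_iff)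
qed

text \<open>This exposes the witness hidden in \<open>schwartz\<close>, so that all mixed
  derivatives can be treated uniformly.\<close>

definition schwartz_family :: "(nat \<Rightarrow> nat \<Rightarrow> real \<times> real \<Rightarrow> complex) \<Rightarrow> bool" where
  "schwartz_family D \<longleftrightarrow>
     (\<forall>j k x y.
        ((\<lambda>s. D j k (s, y)) has_vector_derivative D (Suc j) k (x, y)) (at x) \<and>
        ((\<lambda>s. D j k (x, s)) has_vector_derivative D j (Suc k) (x, y)) (at y)) \<and>
     (\<forall>j k m. \<exists>B. \<forall>p. (1 + norm p) ^ m * norm (D j k p) \<le> B)"

lemma schwartz_iff_family: "schwartz \<phi> \<longleftrightarrow> (\<exists>D. D 0 0 = \<phi> \<and> schwartz_family D)"
  unfolding schwartz_def schwartz_family_def ..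

context
  fixes D assumes D: "schwartz_family D"
begin

lemma schwartz_family_derivatives:
  "((\<lambda>s. D j k (s, y)) has_vector_derivative D (Suc j) k (x, y)) (at x)"
  "((\<lambda>s. D j k (x, s)) has_vector_derivative D j (Suc k) (x, y)) (at y)"
  using D unfolding schwartz_family_def by blast+

lemma schwartz_family_bound: obtains B where "\<And>p. (1 + norm p) ^ m * norm (D j k p) \<le> B"
  using D unfolding schwartz_family_def by blast

text \<open>Only separate partial derivatives are given. Since they are bounded, moving first in x
  and then in y shows joint Lipschitz continuity.\<close>

lemma continuous_on_schwartz_family: "continuous_on S (D j k)"
proof -
  obtain B1 where B1: "\<And>p. norm (D (Suc j) k p) \<le> B1"
    using schwartz_family_bound[of 0 "Suc j" k] by auto
  obtain B2 where B2: "\<And>p. norm (D j (Suc k) p) \<le> B2"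
    using schwartz_family_bound[of 0 j "Suc k"] by auto
  have nonneg: "0 \<le> B1" "0 \<le> B2" using B1 B2 norm_ge_zero order_trans by blast+
  have "(B1 + B2)-lipschitz_on UNIV (D j k)"
  proof (rule lipschitz_onI)
    fix p q :: "real \<times> real"
    obtain x y x' y' where pq: "p = (x, y)" "q = (x', y')" by (metis surj_pair)
    have "norm (D j k (x, y) - D j k (x', y)) \<le> B1 * \<bar>x - x'\<bar>"
      by (rule vector_derivative_lipschitz[OF schwartz_family_derivatives(1) B1])
    moreover have "norm (D j k (x', y) - D j k (x', y')) \<le> B2 * \<bar>y - y'\<bar>"
      by (rule vector_derivative_lipschitz[OF schwartz_family_derivatives(2) B2])
    moreover have "\<bar>x - x'\<bar> \<le> dist p q" "\<bar>y - y'\<bar> \<le> dist p q"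
      using dist_fst_le[of p q] dist_snd_le[of p q] by (auto simp: pq dist_real_def)
    then have "B1 * \<bar>x - x'\<bar> \<le> B1 * dist p q" "B2 * \<bar>y - y'\<bar> \<le> B2 * dist p q"
      using nonneg by (auto intro: mult_left_mono)
    ultimately show "dist (D j k p) (D j k q) \<le> (B1 + B2) * dist p q"
      using norm_diff_triangle_ineq[of "D j k (x, y)" "D j k (x', y)" "D j k (x', y)" "D j k (x', y')"]
      norm_triangle_ineq[of "D j k (x, y) - D j k (x', y)" "D j k (x', y) - D j k (x', y')"]
      by (simp add: dist_norm[of "D j k _"] pq distrib_right)
  qed (use nonneg in simp)
  then show ?thesis
    by (meson lipschitz_on_continuous_on continuous_on_subset subset_UNIV)
qed

lemma measurable_schwartz_family: "D j k \<in> borel_measurable borel"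
  by (intro borel_measurable_continuous_onI continuous_on_schwartz_family)

lemma schwartz_family_decay:
  obtains B where "\<And>p. norm (D j k p) * ((1 + (fst p)\<^sup>2) * (1 + (snd p)\<^sup>2)) \<le> B"
proof -
  obtain B where B: "\<And>p. (1 + norm p) ^ 4 * norm (D j k p) \<le> B"
    using schwartz_family_bound by metis
  show thesis
  proof (rule that)
    fix p
    show "norm (D j k p) * ((1 + (fst p)\<^sup>2) * (1 + (snd p)\<^sup>2)) \<le> B"
      using mult_left_mono[OF one_plus_square_mult_le[of p], of "norm (D j k p)"] B[of p]
      by (simp add: mult.commute)
  qed
qed

lemma integrable_schwartz_family: "integrable lborel (D j k)"
proof -
  obtain B where "\<And>p. norm (D j k p) * ((1 + (fst p)\<^sup>2) * (1 + (snd p)\<^sup>2)) \<le> B"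
    using schwartz_family_decay by metis
  then show ?thesis by (intro integrable_inverse_square_decay measurable_schwartz_family)
qed

lemma integrable_cis_schwartz_family: "integrable lborel (\<lambda>p. cis (p \<bullet> q) * D j k p)"
proof -
  note measurable_schwartz_family [measurable]
  show ?thesis
    by (rule Bochner_Integration.integrable_bound[OF integrable_schwartz_family[of j k]]) (auto simp: norm_mult)
qed

lemma schwartz_family_decay_1d:
  obtains B where "\<And>x y. (1 + x\<^sup>2) * norm (D j k (x, y)) \<le> B" "\<And>x y. (1 + y\<^sup>2) * norm (D j k (x, y)) \<le> B"
proof -
  obtain B where B: "\<And>p. norm (D j k p) * ((1 + (fst p)\<^sup>2) * (1 + (snd p)\<^sup>2)) \<le> B"
    using schwartz_family_decay by metis
  show thesis
  proof (rule that)
    fix x y :: real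
    have le: "1 + x\<^sup>2 \<le> (1 + x\<^sup>2) * (1 + y\<^sup>2)" "1 + y\<^sup>2 \<le> (1 + x\<^sup>2) * (1 + y\<^sup>2)"
      by (simp_all add: algebra_simps)
    show "(1 + x\<^sup>2) * norm (D j k (x, y)) \<le> B" "(1 + y\<^sup>2) * norm (D j k (x, y)) \<le> B"
      using mult_left_mono[OF le(1), of "norm (D j k (x, y))"]
        mult_left_mono[OF le(2), of "norm (D j k (x, y))"] B[of "(x, y)"]
      by (simp_all add: mult.commute)
  qed
qed

lemma continuous_on_schwartz_family_section:
  "continuous_on UNIV (\<lambda>x. D j k (x, y))" "continuous_on UNIV (\<lambda>y. D j k (x, y))"
  by (intro continuous_on_compose2[OF continuous_on_schwartz_family[of UNIV]] continuous_intros; simp)+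

text \<open>By Fubini the x integral is taken first; for fixed y it is a one-dimensional integration
  by parts with offset y times the second frequency.\<close>

lemma inv_fourier_deriv_fst:
  "inv_fourier (D (Suc j) k) q = - \<i> * of_real (fst q) * inv_fourier (D j k) q"
proof -
  obtain B0 where B0: "\<And>x y. (1 + x\<^sup>2) * norm (D j k (x, y)) \<le> B0" using schwartz_family_decay_1d by metis
  obtain B1 where B1: "\<And>x y. (1 + x\<^sup>2) * norm (D (Suc j) k (x, y)) \<le> B1" using schwartz_family_decay_1d by metis
  have parts: "(LINT x|lborel. cis (x * fst q + y * snd q) * D (Suc j) k (x, y))
      = - \<i> * of_real (fst q) * (LINT x|lborel. cis (x * fst q + y * snd q) * D j k (x, y))" for y
    by (rule oscillatory_integration_by_parts[where B = "max B0 B1"])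
       (auto intro: schwartz_family_derivatives continuous_on_schwartz_family_section le_max_iff_disj[THEN iffD2] B0 B1)
  have snd: "inv_fourier (D j' k) q
      = (LINT y|lborel. LINT x|lborel. cis (x * fst q + y * snd q) * D j' k (x, y))" for j'
    unfolding inv_fourier_def using lborel_integral_snd[OF integrable_cis_schwartz_family[of q j' k]]
    by (simp add: inner_prod_def)
  show ?thesis unfolding snd parts by simp
qed

lemma inv_fourier_deriv_snd:
  "inv_fourier (D j (Suc k)) q = - \<i> * of_real (snd q) * inv_fourier (D j k) q"
proof -
  obtain B0 where B0: "\<And>x y. (1 + y\<^sup>2) * norm (D j k (x, y)) \<le> B0" using schwartz_family_decay_1d by metis
  obtain B1 where B1: "\<And>x y. (1 + y\<^sup>2) * norm (D j (Suc k) (x, y)) \<le> B1" using schwartz_family_decay_1d by metis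
  have parts: "(LINT y|lborel. cis (y * snd q + x * fst q) * D j (Suc k) (x, y))
      = - \<i> * of_real (snd q) * (LINT y|lborel. cis (y * snd q + x * fst q) * D j k (x, y))" for x
    by (rule oscillatory_integration_by_parts[where B = "max B0 B1"])
       (auto intro: schwartz_family_derivatives continuous_on_schwartz_family_section le_max_iff_disj[THEN iffD2] B0 B1)
  have fst: "inv_fourier (D j k') q
      = (LINT x|lborel. LINT y|lborel. cis (y * snd q + x * fst q) * D j k' (x, y))" for k'
    unfolding inv_fourier_def using lborel_integral_fst[OF integrable_cis_schwartz_family[of q j k']]
    by (simp add: inner_prod_def add.commute)
  show ?thesis unfolding fst parts by simp
qed

lemma integrable_inv_fourier_schwartz_family: "integrable lborel (inv_fourier (D 0 0))"
proof (rule integrable_inverse_square_decay)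
  note measurable_schwartz_family [measurable]
  show "inv_fourier (D 0 0) \<in> borel_measurable borel"
    unfolding inv_fourier_def[abs_def]
    by (rule lborel.borel_measurable_lebesgue_integral) measurable
  fix q :: "real \<times> real"
  define N where "N j k = (LINT p|lborel. norm (D j k p))" for j k
  have N: "norm (inv_fourier (D j k) q) \<le> N j k" for j k
    unfolding inv_fourier_def N_def
    using integral_norm_bound[of lborel "\<lambda>p. cis (p \<bullet> q) * D j k p"] by (simp add: norm_mult)
  define w where "w = (1 + (fst q)\<^sup>2) * (1 + (snd q)\<^sup>2)"
  \<comment> \<open>Two derivatives in one variable multiply the transform by minus the square of
    the frequency, so the weight w corresponds to the operator (1 - d_x^2)(1 - d_y^2), whose
    expansion has these four terms.\<close>
  have "of_real w * inv_fourier (D 0 0) q = inv_fourier (D 0 0) q - inv_fourier (D 2 0) q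
      - inv_fourier (D 0 2) q + inv_fourier (D 2 2) q"
    by (simp add: w_def numeral_2_eq_2 inv_fourier_deriv_fst inv_fourier_deriv_snd algebra_simps)
  also have "norm \<dots> \<le> norm (inv_fourier (D 0 0) q) + norm (inv_fourier (D 2 0) q)
      + norm (inv_fourier (D 0 2) q) + norm (inv_fourier (D 2 2) q)"
    by norm
  also have "\<dots> \<le> N 0 0 + N 2 0 + N 0 2 + N 2 2"
    by (intro add_mono N)
  finally show "norm (inv_fourier (D 0 0) q) * ((1 + (fst q)\<^sup>2) * (1 + (snd q)\<^sup>2)) \<le> N 0 0 + N 2 0 + N 0 2 + N 2 2"
    by (simp add: norm_mult w_def[symmetric]) (simp add: w_def mult.commute)
qed

end

lemma schwartz_integrable:
  assumes "schwartz \<phi>"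
  shows "integrable lborel \<phi>" "integrable lborel (inv_fourier \<phi>)"
  using assms integrable_schwartz_family integrable_inv_fourier_schwartz_family
  unfolding schwartz_iff_family by metis+

subsection \<open>The distributional inverse transform\<close>

text \<open>A convergent sequence of parameters is bounded by some K, and on Im z = 1 the integrands
  have the common majorant exp(1 + K - 3 a^2).\<close>

lemma continuous_on_airy: "continuous_on S airy"
proof -
  have "continuous_on UNIV airy"
    unfolding continuous_on_sequentially
  proof (intro allI ballI impI, elim conjE)
    fix X :: "nat \<Rightarrow> real" and s :: real
    assume X: "X \<longlonglongrightarrow> s"
    then obtain K where K: "\<And>n. norm (X n) \<le> K"
      using Bseq_def convergent_def convergent_imp_Bseq by metis
    show "(airy \<circ> X) \<longlonglongrightarrow> airy s"
      unfolding o_def airy_def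
    proof (rule integral_dominated_convergence)
      show "integrable lborel (\<lambda>a. exp (1 + K) * exp (- 3 * (a - 0)\<^sup>2))"
        using has_bochner_integral_gaussian[of 3 0]
        by (intro integrable_mult_right) (simp add: has_bochner_integral_iff)
      show "AE a in lborel. (\<lambda>n. airy_integrand (X n) (Complex a 1)) \<longlonglongrightarrow> airy_integrand s (Complex a 1)"
        unfolding airy_integrand_def by (intro AE_I2 tendsto_intros X)
      show "AE a in lborel. norm (airy_integrand (X n) (Complex a 1)) \<le> exp (1 + K) * exp (- 3 * (a - 0)\<^sup>2)" for n
        using K[of n] by (intro AE_I2) (simp add: norm_airy_integrand mult_exp_exp abs_le_iff)
    qed (simp, intro borel_measurable_continuous_onI continuous_intros)+
  qed
  then show ?thesis by (rule continuous_on_subset) simp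
qed

lemma measurable_airy [measurable]: "airy \<in> borel_measurable borel"
  by (intro borel_measurable_continuous_onI continuous_on_airy)

text \<open>Shifting the contour by \<open>\<delta>\<close> makes the cubic phase absolutely integrable; this is the
  regularised multiplier.\<close>

definition cubic :: "real \<Rightarrow> real \<Rightarrow> complex" where
  "cubic \<delta> a = airy_integrand 0 (Complex a \<delta>)"

lemma measurable_cubic [measurable]: "cubic \<delta> \<in> borel_measurable borel"
  unfolding cubic_def[abs_def] by (intro borel_measurable_continuous_onI continuous_intros)

lemma measurable_cubic_prod [measurable]:
  "(\<lambda>q::real \<times> real. cubic \<delta> (fst q) * cubic \<delta> (snd q)) \<in> borel_measurable borel"
  unfolding cubic_def[abs_def] by (intro borel_measurable_continuous_onI continuous_intros)

lemma integrable_cubic: "0 < \<delta> \<Longrightarrow> integrable lborel (cubic \<delta>)"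
  unfolding cubic_def[abs_def] by (rule integrable_airy_integrand)

lemma norm_cubic_le:
  assumes "0 \<le> \<delta>" "\<delta> \<le> 1"
  shows "norm (cubic \<delta> a) \<le> exp 1"
proof -
  have "\<delta> * \<delta>\<^sup>2 \<le> 1 * 1" using assms by (intro mult_mono) (auto simp: power_le_one)
  moreover have "0 \<le> \<delta> * (3 * a\<^sup>2)" using assms by simp
  ultimately show ?thesis
    by (simp add: cubic_def norm_airy_integrand algebra_simps)
qed

lemma cubic_tendsto: "(\<lambda>n. cubic (1 / real (Suc n)) a) \<longlonglongrightarrow> cubic 0 a"
proof -
  have lim: "(\<lambda>n. 1 / real (Suc n)) \<longlonglongrightarrow> 0" by real_asymp
  show ?thesis
    unfolding cubic_def airy_integrand_def by (intro tendsto_intros lim)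
qed

text \<open>The character is evaluated at the real point a, not at a + i \<delta>; the discrepancy
  is the factor exp(\<delta> s), and \<open>airy_shift\<close> removes the remaining dependence on
  \<delta>.\<close>

lemma integral_cubic_cis:
  assumes "0 < \<delta>"
  shows "(LINT a|lborel. cubic \<delta> a * cis (a * s)) = of_real (exp (\<delta> * s)) * airy s"
proof -
  have "cubic \<delta> a * cis (a * s) = of_real (exp (\<delta> * s)) * airy_integrand s (Complex a \<delta>)" for a
    unfolding cubic_def airy_integrand_def cis_conv_exp Complex_eq exp_of_real[symmetric] mult_exp_exp
    by (rule arg_cong[of _ _ exp]) (simp add: algebra_simps)
  then show ?thesis by (simp add: airy_shift[OF assms])
qed

text \<open>A majorant independent of \<delta>: for s \<ge> 0 the growth exp(\<delta> s) is absorbed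
  by the decay exp(-s), and for s < 0 the factor is at most 1.\<close>

lemma norm_exp_airy_le:
  assumes "\<And>s. norm (airy s) \<le> C" "\<And>s. norm (airy s) \<le> C * exp (- s)" "0 \<le> \<delta>" "\<delta> \<le> 1"
  shows "norm (of_real (exp (\<delta> * s)) * airy s) \<le> C"
proof (cases "0 \<le> s")
  case True
  have "norm (of_real (exp (\<delta> * s)) * airy s) \<le> exp s * (C * exp (- s))"
    unfolding norm_mult using True assms by (intro mult_mono) (auto simp: mult_left_le_one_le)
  also have "\<dots> = C" by (simp add: exp_minus)
  finally show ?thesis .
next
  case False
  have "norm (of_real (exp (\<delta> * s)) * airy s) \<le> 1 * C"
    unfolding norm_mult using False assms by (intro mult_mono) (auto simp: mult_nonneg_nonpos)
  then show ?thesis by simp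
qed

text \<open>\<open>arg1 k p\<close> and \<open>arg2 k p\<close> are the components of the transpose
  of \<open>rot k\<close> applied to p, as \<open>inner_rot\<close> records.\<close>

definition arg1 :: "real \<Rightarrow> real \<times> real \<Rightarrow> real" where
  "arg1 k p = k * (fst p + sqrt 3 * snd p) / 2"

definition arg2 :: "real \<Rightarrow> real \<times> real \<Rightarrow> real" where
  "arg2 k p = k * (fst p - sqrt 3 * snd p) / 2"

lemma continuous_on_arg [continuous_intros]: "continuous_on S (arg1 k)" "continuous_on S (arg2 k)"
  unfolding arg1_def[abs_def] arg2_def[abs_def] by (auto intro!: continuous_intros)

lemma measurable_arg [measurable]:
  "arg1 k \<in> borel_measurable borel" "arg2 k \<in> borel_measurable borel"
  by (intro borel_measurable_continuous_onI continuous_intros)+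

lemma inner_rot: "p \<bullet> rot k q = fst q * arg1 k p + snd q * arg2 k p"
  by (simp add: inner_prod_def rot_def arg1_def arg2_def algebra_simps add_divide_distrib diff_divide_distrib)

text \<open>The rotation diagonalises the phase: \<open>t (\<xi>\<^sup>3 + \<xi> \<eta>\<^sup>2) = a\<^sup>3 + b\<^sup>3\<close> for
  \<open>(\<xi>, \<eta>) = rot k (a, b)\<close>, provided \<open>t k\<^sup>3 = 2\<close>.\<close>

lemma multiplier_rot:
  assumes "t * k ^ 3 = 2"
  shows "multiplier t (rot k q) = cubic 0 (fst q) * cubic 0 (snd q)"
proof -
  obtain a b where q: "q = (a, b)" by (cases q)
  have s3: "sqrt 3 * (sqrt 3 * z) = 3 * z" for z :: real by (simp add: mult.assoc[symmetric])
  have "t * ((k * (a + b) / 2) ^ 3 + k * (a + b) / 2 * (k * sqrt 3 * (a - b) / 2)\<^sup>2)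
      = t * k ^ 3 * (a ^ 3 + b ^ 3) / 2"
    by (simp add: power2_eq_square power3_eq_cube field_simps s3)
  also have "\<dots> = a ^ 3 + b ^ 3" using assms by simp
  finally have "multiplier t (rot k q) = exp (\<i> * of_real (a ^ 3 + b ^ 3))"
    by (simp only: multiplier_def rot_def q prod.case fst_conv snd_conv)
  then show ?thesis
    by (simp add: cubic_def airy_integrand_def q Complex_eq exp_add[symmetric] algebra_simps)
qed

definition airy_product :: "real \<Rightarrow> real \<times> real \<Rightarrow> complex" where
  "airy_product k p = of_real (k\<^sup>2 * sqrt 3 / 2) * (airy (arg1 k p) * airy (arg2 k p))"

lemma continuous_on_airy_product: "continuous_on S (airy_product k)"
  unfolding airy_product_def[abs_def]
  by (intro continuous_intros continuous_on_compose2[OF continuous_on_airy]) auto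

text \<open>For \<delta> > 0 the regularised multiplier is integrable, so the double integral is
  dominated by |\<phi>(p)| |M(q)| and Fubini applies. The inner integral over q then separates into
  two one-dimensional Airy integrals.\<close>

lemma regularised_pairing:
  assumes \<phi>: "integrable lborel \<phi>" and \<delta>: "0 < \<delta>"
  shows "(LINT q|lborel. cubic \<delta> (fst q) * cubic \<delta> (snd q) * inv_fourier \<phi> (rot k q))
    = (LINT p|lborel. (of_real (exp (\<delta> * arg1 k p)) * airy (arg1 k p)) *
        (of_real (exp (\<delta> * arg2 k p)) * airy (arg2 k p)) * \<phi> p)"
proof -
  define M where "M q = cubic \<delta> (fst q) * cubic \<delta> (snd q)" for q
  define G where "G p q = M q * (cis (p \<bullet> rot k q) * \<phi> p)" for p q
  have [measurable]: "M \<in> borel_measurable borel" unfolding M_def[abs_def] by (rule measurable_cubic_prod)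
  have [measurable]: "\<phi> \<in> borel_measurable borel" using borel_measurable_integrable[OF \<phi>] by simp
  have M: "integrable lborel M"
    unfolding M_def[abs_def] by (intro integrable_lborel_prod integrable_cubic \<delta>)
  have int: "integrable (lborel \<Otimes>\<^sub>M lborel) (case_prod G)"
  proof (rule Bochner_Integration.integrable_bound)
    show "integrable (lborel \<Otimes>\<^sub>M lborel) (\<lambda>z. \<phi> (fst z) * M (snd z))"
      using integrable_lborel_prod(1)[OF \<phi> M] by (simp add: lborel_prod)
    show "case_prod G \<in> borel_measurable (lborel \<Otimes>\<^sub>M lborel)"
      unfolding G_def[abs_def] by measurable
  qed (auto simp: G_def norm_mult)
  have inner: "(LINT q|lborel. G p q) = (of_real (exp (\<delta> * arg1 k p)) * airy (arg1 k p)) *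
        (of_real (exp (\<delta> * arg2 k p)) * airy (arg2 k p)) * \<phi> p" for p
  proof -
    have c: "integrable lborel (\<lambda>a. cubic \<delta> a * cis (a * s))" for s
      by (rule Bochner_Integration.integrable_bound[OF integrable_cubic[OF \<delta>]]) (auto simp: norm_mult)
    have "G p q = (cubic \<delta> (fst q) * cis (fst q * arg1 k p)) * (cubic \<delta> (snd q) * cis (snd q * arg2 k p)) * \<phi> p" for q
      by (simp add: G_def M_def inner_rot flip: cis_mult)
    then show ?thesis
      using integrable_lborel_prod(2)[OF c c] by (simp add: integral_cubic_cis[OF \<delta>])
  qed
  have "(LINT q|lborel. M q * inv_fourier \<phi> (rot k q)) = (LINT q|lborel. LINT p|lborel. G p q)"
    unfolding G_def inv_fourier_def by simp
  also have "\<dots> = (LINT p|lborel. LINT q|lborel. G p q)"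
    by (rule lborel_pair.Fubini_integral[OF int])
  finally show ?thesis unfolding M_def inner .
qed

text \<open>Let \<delta> = 1/(n+1) tend to 0 in the regularised identity. One side is dominated by a
  multiple of |\<phi>|, the other by a multiple of the modulus of its transform composed with
  \<open>rot k\<close>. The change of variables then restores the multiplier.\<close>

lemma represents_airy_product:
  assumes t: "0 < t" and k: "0 < k" "t * k ^ 3 = 2"
  shows "represents_inv_fourier (airy_product k) (multiplier t)"
  unfolding represents_inv_fourier_def
proof (intro allI impI conjI)
  fix \<phi> assume "schwartz \<phi>"
  note \<phi> = schwartz_integrable[OF this]
  have [measurable]: "\<phi> \<in> borel_measurable borel" "inv_fourier \<phi> \<in> borel_measurable borel"
    using \<phi>[THEN borel_measurable_integrable] by simp_all
  have [measurable]: "multiplier t \<in> borel_measurable borel"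
    unfolding multiplier_def case_prod_beta by (intro borel_measurable_continuous_onI continuous_intros)
  obtain C where C: "0 < C" "\<And>s. norm (airy s) \<le> C" "\<And>s. norm (airy s) \<le> C * exp (- s)"
    using airy_bounds by metis
  define E where "E \<delta> p = (of_real (exp (\<delta> * arg1 k p)) * airy (arg1 k p)) *
        (of_real (exp (\<delta> * arg2 k p)) * airy (arg2 k p)) * \<phi> p" for \<delta> p
  have [measurable]: "E \<delta> \<in> borel_measurable borel" for \<delta> unfolding E_def[abs_def] by measurable
  have bound: "norm (E \<delta> p) \<le> C * C * norm (\<phi> p)" if "0 \<le> \<delta>" "\<delta> \<le> 1" for \<delta> p
    unfolding E_def norm_mult[of _ "\<phi> p"] norm_mult[of "_ * airy (arg1 k p)"]
    using C that by (intro mult_right_mono mult_mono norm_exp_airy_le) auto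
  have dom: "integrable lborel (\<lambda>p. C * C * norm (\<phi> p))"
    by (intro integrable_mult_right integrable_norm \<phi>)
  have "integrable lborel (E 0)"
    by (rule Bochner_Integration.integrable_bound[OF dom]) (use bound[of 0] C in auto)
  then have int: "integrable lborel (\<lambda>p. of_real (k\<^sup>2 * sqrt 3 / 2) * E 0 p)"
    by (rule integrable_mult_right)
  have E0: "of_real (k\<^sup>2 * sqrt 3 / 2) * E 0 p = airy_product k p * \<phi> p" for p
    by (simp add: E_def airy_product_def)
  show "integrable lborel (\<lambda>p. airy_product k p * \<phi> p)"
    using int unfolding E0 .
  have lim: "(\<lambda>n. LINT p|lborel. E (1 / real (Suc n)) p) \<longlonglongrightarrow> (LINT p|lborel. E 0 p)"
  proof (rule integral_dominated_convergence[OF _ _ dom])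
    have "(\<lambda>n. 1 / real (Suc n)) \<longlonglongrightarrow> 0" by real_asymp
    then show "AE p in lborel. (\<lambda>n. E (1 / real (Suc n)) p) \<longlonglongrightarrow> E 0 p"
      unfolding E_def by (intro AE_I2 tendsto_intros)
    show "AE p in lborel. norm (E (1 / real (Suc n)) p) \<le> C * C * norm (\<phi> p)" for n
      by (intro AE_I2 bound) auto
  qed simp_all
  have reg: "(LINT p|lborel. E (1 / real (Suc n)) p)
      = (LINT q|lborel. cubic (1 / real (Suc n)) (fst q) * cubic (1 / real (Suc n)) (snd q) * inv_fourier \<phi> (rot k q))" for n
    unfolding E_def by (rule regularised_pairing[OF \<phi>(1), symmetric]) simp
  have "(\<lambda>n. LINT q|lborel. cubic (1 / real (Suc n)) (fst q) * cubic (1 / real (Suc n)) (snd q)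
        * inv_fourier \<phi> (rot k q))
      \<longlonglongrightarrow> (LINT q|lborel. cubic 0 (fst q) * cubic 0 (snd q) * inv_fourier \<phi> (rot k q))"
  proof (rule integral_dominated_convergence)
    show "integrable lborel (\<lambda>q. exp 1 * exp 1 * norm (inv_fourier \<phi> (rot k q)))"
      by (intro integrable_mult_right integrable_norm lborel_integral_rot(2) k \<phi>) simp
    show "AE q in lborel. (\<lambda>n. cubic (1 / real (Suc n)) (fst q) * cubic (1 / real (Suc n)) (snd q)
        * inv_fourier \<phi> (rot k q)) \<longlonglongrightarrow> cubic 0 (fst q) * cubic 0 (snd q) * inv_fourier \<phi> (rot k q)"
      by (intro AE_I2 tendsto_intros cubic_tendsto)
    show "AE q in lborel. norm (cubic (1 / real (Suc n)) (fst q) * cubic (1 / real (Suc n)) (snd q)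
        * inv_fourier \<phi> (rot k q)) \<le> exp 1 * exp 1 * norm (inv_fourier \<phi> (rot k q))" for n
      unfolding norm_mult by (intro AE_I2 mult_right_mono mult_mono norm_cubic_le) auto
  qed (use measurable_cubic_prod in \<open>auto intro!: borel_measurable_times measurable_compose[OF measurable_rot]\<close>)
  \<comment> \<open>Both limits belong to the same sequence, by \<open>reg\<close>, and hence
    coincide.\<close>
  then have eq: "(LINT p|lborel. E 0 p)
      = (LINT q|lborel. cubic 0 (fst q) * cubic 0 (snd q) * inv_fourier \<phi> (rot k q))"
    unfolding reg[symmetric] using lim LIMSEQ_unique by blast
  have "(LINT q|lborel. multiplier t q * inv_fourier \<phi> q)
      = of_real (k\<^sup>2 * sqrt 3 / 2) * (LINT q|lborel. multiplier t (rot k q) * inv_fourier \<phi> (rot k q))"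
    by (rule lborel_integral_rot) (use k in simp_all)
  also have "\<dots> = of_real (k\<^sup>2 * sqrt 3 / 2) * (LINT p|lborel. E 0 p)"
    by (simp only: multiplier_rot[OF k(2)] eq)
  also have "\<dots> = (LINT p|lborel. of_real (k\<^sup>2 * sqrt 3 / 2) * E 0 p)"
    by simp
  finally show "(LINT p|lborel. airy_product k p * \<phi> p) = (LINT q|lborel. multiplier t q * inv_fourier \<phi> q)"
    unfolding E0 by simp
qed

subsection \<open>Uniqueness of the continuous representative\<close>

text \<open>One factor |x| costs half of a Gaussian exponent; this is the step from one degree to
  the next in \<open>poly_gaussian_bounded\<close>.\<close>

lemma abs_le_exp_square:
  fixes k x :: real
  assumes "0 < k"
  shows "\<bar>x\<bar> \<le> (1 + 2 / k) * exp (k / 2 * x\<^sup>2)"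
proof -
  have "\<bar>x\<bar> \<le> 1 + x\<^sup>2"
    using power2_diff[of "\<bar>x\<bar>" 1] zero_le_power2[of "\<bar>x\<bar> - 1"] zero_le_power2[of x] by simp
  also have "\<dots> \<le> (1 + 2 / k) * (1 + k / 2 * x\<^sup>2)"
    using assms by (simp add: field_simps)
  also have "\<dots> \<le> (1 + 2 / k) * exp (k / 2 * x\<^sup>2)"
    using assms by (intro mult_left_mono exp_ge_add_one_self) auto
  finally show ?thesis .
qed

text \<open>Induction along Horner's scheme with k kept general: exp(-k x^2) is split into two
  halves, one absorbing the factor x and the other the remaining polynomial.\<close>

lemma poly_gaussian_bounded:
  fixes p :: "real poly"
  assumes "0 < k"
  shows "\<exists>B. \<forall>x. \<bar>poly p x\<bar> * exp (- k * x\<^sup>2) \<le> B"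
  using assms
proof (induction p arbitrary: k)
  case 0
  show ?case by (intro exI[of _ 0]) simp
next
  case (pCons a p)
  then obtain B where B: "\<And>x. \<bar>poly p x\<bar> * exp (- (k / 2) * x\<^sup>2) \<le> B"
    using pCons.IH[of "k / 2"] by auto
  have B0: "0 \<le> B" using order_trans[OF _ B[of 0]] by simp
  have "\<bar>poly (pCons a p) x\<bar> * exp (- k * x\<^sup>2) \<le> \<bar>a\<bar> + (1 + 2 / k) * B" for x
  proof -
    have half: "exp (- k * x\<^sup>2) = exp (- (k / 2) * x\<^sup>2) * exp (- (k / 2) * x\<^sup>2)"
      by (simp add: mult_exp_exp)
    have x: "\<bar>x\<bar> * exp (- (k / 2) * x\<^sup>2) \<le> 1 + 2 / k"
      using abs_le_exp_square[OF \<open>0 < k\<close>, of x] by (simp add: exp_minus field_simps)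
    have "\<bar>poly (pCons a p) x\<bar> * exp (- k * x\<^sup>2) \<le> (\<bar>a\<bar> + \<bar>x\<bar> * \<bar>poly p x\<bar>) * exp (- k * x\<^sup>2)"
      by (intro mult_right_mono) (auto simp: abs_mult[symmetric] intro: abs_triangle_ineq)
    also have "\<dots> = \<bar>a\<bar> * exp (- k * x\<^sup>2)
        + (\<bar>x\<bar> * exp (- (k / 2) * x\<^sup>2)) * (\<bar>poly p x\<bar> * exp (- (k / 2) * x\<^sup>2))"
      unfolding half by (simp add: algebra_simps)
    also have "\<dots> \<le> \<bar>a\<bar> * 1 + (1 + 2 / k) * B"
      using \<open>0 < k\<close> by (intro add_mono mult_mono x B) auto
    finally show ?thesis by simp
  qed
  then show ?case by blast
qed

text \<open>Hermite polynomials up to sign and scaling: the j-th derivative of exp(-k x^2) is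
  \<open>gauss_poly k j\<close> times exp(-k x^2).\<close>

fun gauss_poly :: "real \<Rightarrow> nat \<Rightarrow> real poly" where
  "gauss_poly k 0 = 1"
| "gauss_poly k (Suc j) = pderiv (gauss_poly k j) - [:0, 2 * k:] * gauss_poly k j"

definition gauss_deriv :: "real \<Rightarrow> real \<Rightarrow> nat \<Rightarrow> real \<Rightarrow> real" where
  "gauss_deriv k m j x = poly (gauss_poly k j) (x - m) * exp (- k * (x - m)\<^sup>2)"

lemma gauss_deriv_0: "gauss_deriv k m 0 x = exp (- k * (x - m)\<^sup>2)"
  by (simp add: gauss_deriv_def)

lemma gauss_deriv_has_derivative:
  "(gauss_deriv k m j has_real_derivative gauss_deriv k m (Suc j) x) (at x)"
  unfolding gauss_deriv_def[abs_def]
  by (auto intro!: derivative_eq_intros DERIV_chain2[OF poly_DERIV] simp: algebra_simps)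

lemma gauss_deriv_bounded:
  assumes "0 < k"
  obtains B where "\<And>x. (1 + \<bar>x\<bar>) ^ n * \<bar>gauss_deriv k m j x\<bar> \<le> B" "0 \<le> B"
proof -
  \<comment> \<open>As a polynomial in x - m this is 2 + x^2, which dominates 1 + |x|; the weight
    thus becomes a polynomial factor.\<close>
  define Q where "Q = [:2 + m\<^sup>2, 2 * m, 1:]"
  have Q: "1 + \<bar>x\<bar> \<le> poly Q (x - m)" for x
  proof -
    have "poly Q (x - m) = 2 + x\<^sup>2"
      by (simp add: Q_def algebra_simps power2_eq_square)
    then show ?thesis
      using power2_diff[of "\<bar>x\<bar>" 1] zero_le_power2[of "\<bar>x\<bar> - 1"] zero_le_power2[of x] by simp
  qed
  obtain B where B: "\<And>u. \<bar>poly (Q ^ n * gauss_poly k j) u\<bar> * exp (- k * u\<^sup>2) \<le> B"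
    using poly_gaussian_bounded[OF assms] by metis
  have le: "(1 + \<bar>x\<bar>) ^ n * \<bar>gauss_deriv k m j x\<bar> \<le> B" for x
  proof -
    have "(1 + \<bar>x\<bar>) ^ n \<le> \<bar>poly Q (x - m) ^ n\<bar>"
      using Q[of x] by (intro order_trans[OF power_mono abs_ge_self]) auto
    then have "(1 + \<bar>x\<bar>) ^ n * \<bar>gauss_deriv k m j x\<bar> \<le> \<bar>poly Q (x - m) ^ n\<bar> * \<bar>gauss_deriv k m j x\<bar>"
      by (intro mult_right_mono) auto
    also have "\<dots> = \<bar>poly (Q ^ n * gauss_poly k j) (x - m)\<bar> * exp (- k * (x - m)\<^sup>2)"
      by (simp add: gauss_deriv_def abs_mult)
    also have "\<dots> \<le> B" by (rule B)
    finally show ?thesis .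
  qed
  moreover have "0 \<le> B"
    using order_trans[OF _ le[of 0]] by simp
  ultimately show thesis by (rule that)
qed

section \<open>Plane Gaussians as test functions\<close>

definition gaussian :: "real \<Rightarrow> real \<times> real \<Rightarrow> real \<times> real \<Rightarrow> real" where
  "gaussian k m p = exp (- k * (fst p - fst m)\<^sup>2) * exp (- k * (snd p - snd m)\<^sup>2)"

lemma schwartz_gaussian:
  assumes "0 < k"
  shows "schwartz (\<lambda>p. of_real (gaussian k m p))"
  unfolding schwartz_def
proof -
  define D :: "nat \<Rightarrow> nat \<Rightarrow> real \<times> real \<Rightarrow> complex" where
    "D i j p = of_real (gauss_deriv k (fst m) i (fst p) * gauss_deriv k (snd m) j (snd p))" for i j p
  have D0: "D 0 0 = (\<lambda>p. of_real (gaussian k m p))"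
    by (simp add: D_def gauss_deriv_0 gaussian_def fun_eq_iff)
  have D1: "((\<lambda>s. D i j (s, y)) has_vector_derivative D (Suc i) j (x, y)) (at x)" for i j x y
    unfolding D_def fst_conv snd_conv
    by (intro has_vector_derivative_of_real)
       (auto intro!: derivative_eq_intros gauss_deriv_has_derivative
          simp: has_real_derivative_iff_has_vector_derivative[symmetric])
  have D2: "((\<lambda>s. D i j (x, s)) has_vector_derivative D i (Suc j) (x, y)) (at y)" for i j x y
    unfolding D_def fst_conv snd_conv
    by (intro has_vector_derivative_of_real)
       (auto intro!: derivative_eq_intros gauss_deriv_has_derivative
          simp: has_real_derivative_iff_has_vector_derivative[symmetric])
  have D3: "\<exists>B. \<forall>p. (1 + norm p) ^ n * norm (D i j p) \<le> B" for i j n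
  proof -
    obtain B1 where B1: "\<And>x. (1 + \<bar>x\<bar>) ^ n * \<bar>gauss_deriv k (fst m) i x\<bar> \<le> B1" "0 \<le> B1"
      using gauss_deriv_bounded[OF assms] by metis
    obtain B2 where B2: "\<And>x. (1 + \<bar>x\<bar>) ^ n * \<bar>gauss_deriv k (snd m) j x\<bar> \<le> B2" "0 \<le> B2"
      using gauss_deriv_bounded[OF assms] by metis
    show ?thesis
    proof (intro exI allI)
      fix p :: "real \<times> real"
      \<comment> \<open>The radial weight is bounded by a product of one-variable weights, matching
        the product form of D.\<close>
      have "norm p \<le> \<bar>fst p\<bar> + \<bar>snd p\<bar>" using norm_Pair_le[of "fst p" "snd p"] by simp
      then have "1 + norm p \<le> (1 + \<bar>fst p\<bar>) * (1 + \<bar>snd p\<bar>)"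
        using mult_nonneg_nonneg[OF abs_ge_zero[of "fst p"] abs_ge_zero[of "snd p"]]
        unfolding distrib_left distrib_right by linarith
      then have "(1 + norm p) ^ n \<le> ((1 + \<bar>fst p\<bar>) * (1 + \<bar>snd p\<bar>)) ^ n"
        by (intro power_mono) auto
      then have "(1 + norm p) ^ n * norm (D i j p) \<le> ((1 + \<bar>fst p\<bar>) * (1 + \<bar>snd p\<bar>)) ^ n * norm (D i j p)"
        by (intro mult_right_mono) auto
      also have "\<dots> = ((1 + \<bar>fst p\<bar>) ^ n * \<bar>gauss_deriv k (fst m) i (fst p)\<bar>) *
          ((1 + \<bar>snd p\<bar>) ^ n * \<bar>gauss_deriv k (snd m) j (snd p)\<bar>)"
        unfolding D_def norm_of_real by (simp add: abs_mult power_mult_distrib)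
      also have "\<dots> \<le> B1 * B2"
        using B1 B2 by (intro mult_mono) auto
      finally show "(1 + norm p) ^ n * norm (D i j p) \<le> B1 * B2" .
    qed
  qed
  show "\<exists>D. D 0 0 = (\<lambda>p. complex_of_real (gaussian k m p)) \<and>
        (\<forall>i j x y. ((\<lambda>s. D i j (s, y)) has_vector_derivative D (Suc i) j (x, y)) (at x) \<and>
                   ((\<lambda>s. D i j (x, s)) has_vector_derivative D i (Suc j) (x, y)) (at y)) \<and>
        (\<forall>i j n. \<exists>B. \<forall>p. (1 + norm p) ^ n * norm (D i j p) \<le> B)"
    using D0 D1 D2 D3 by blast
qed

lemma gaussian_nonneg: "0 \<le> gaussian k m p"
  by (simp add: gaussian_def)

lemma integral_gaussian:
  assumes "0 < k"
  shows "integrable lborel (gaussian k m)" "(LINT p|lborel. gaussian k m p) = pi / k"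
proof -
  have i: "integrable lborel (\<lambda>x. exp (- k * (x - c)\<^sup>2))" "(LINT x|lborel. exp (- k * (x - c)\<^sup>2)) = sqrt (pi / k)" for c
    using has_bochner_integral_gaussian[OF assms, of c] by (simp_all add: has_bochner_integral_iff)
  show "integrable lborel (gaussian k m)"
    unfolding gaussian_def[abs_def] by (rule integrable_lborel_prod(1)[OF i(1) i(1)])
  show "(LINT p|lborel. gaussian k m p) = pi / k"
    unfolding gaussian_def[abs_def] integrable_lborel_prod(2)[OF i(1) i(1)] i(2)
    using assms by simp
qed

lemma gaussian_eq_exp_dist: "gaussian k m p = exp (- k * (dist p m)\<^sup>2)"
  by (simp add: gaussian_def dist_Pair_Pair[of "fst p" "snd p" "fst m" "snd m", simplified]
      dist_real_def mult_exp_exp algebra_simps)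

text \<open>A continuous function is tested against Gaussians concentrating at a point; away from that
  point the mass is controlled by the integrability against the unit Gaussian.\<close>

lemma continuous_eq_0_if_gaussian_orthogonal:
  fixes w :: "real \<times> real \<Rightarrow> complex"
  assumes cont: "continuous_on UNIV w"
    and int: "\<And>k. 0 < k \<Longrightarrow> integrable lborel (\<lambda>p. w p * of_real (gaussian k m p))"
    and zero: "\<And>k. 0 < k \<Longrightarrow> (LINT p|lborel. w p * of_real (gaussian k m p)) = 0"
  shows "w m = 0"
proof -
  \<comment> \<open>Subtracting the value at m makes the function small near m; by orthogonality its
    Gaussian integrals then equal -w(m) pi/k.\<close>
  define v where "v p = w p - w m" for p
  have gm: "integrable lborel (\<lambda>p. w m * of_real (gaussian k m p))" if "0 < k" for k
    using integral_gaussian(1)[OF that] by (intro integrable_mult_right integrable_of_real)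
  have intv: "integrable lborel (\<lambda>p. v p * of_real (gaussian k m p))" if "0 < k" for k
    unfolding v_def left_diff_distrib using int[OF that] gm[OF that] by (rule Bochner_Integration.integrable_diff)
  have intv': "integrable lborel (\<lambda>p. norm (v p) * gaussian k m p)" if "0 < k" for k
    using integrable_norm[OF intv[OF that]] by (simp add: norm_mult gaussian_def)
  have val: "(LINT p|lborel. v p * of_real (gaussian k m p)) = - w m * of_real (pi / k)" if "0 < k" for k
    unfolding v_def left_diff_distrib using int[OF that] gm[OF that]
    by (subst Bochner_Integration.integral_diff) (simp_all add: zero that integral_gaussian)
  define M where "M = (LINT p|lborel. norm (v p) * gaussian 1 m p)"
  have main: "norm (w m) \<le> e" if "0 < e" for e
  proof -
    obtain d where d: "0 < d" "\<And>p. dist p m < d \<Longrightarrow> norm (v p) \<le> e"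
      using cont \<open>0 < e\<close> unfolding continuous_on_iff v_def by (metis UNIV_I dist_norm less_imp_le)
    \<comment> \<open>Multiplying by k normalises the mass pi/k; the contribution from outside the
      disc of radius d becomes k exp(-(k-1) d^2), which tends to 0.\<close>
    have bound: "norm (w m) * pi \<le> e * pi + M * (k * exp (- (k - 1) * d\<^sup>2))" if k: "1 < k" for k
    proof -
      have k0: "0 < k" using k by simp
      have "norm (w m) * (pi / k) = norm (LINT p|lborel. v p * of_real (gaussian k m p))"
        unfolding val[OF k0] norm_mult norm_minus_cancel norm_of_real using k0 by simp
      also have "\<dots> \<le> (LINT p|lborel. e * gaussian k m p + exp (- (k - 1) * d\<^sup>2) * (norm (v p) * gaussian 1 m p))"
      proof (rule Bochner_Integration.integral_norm_bound_integral)
        show "integrable lborel (\<lambda>p. v p * of_real (gaussian k m p))" by (rule intv[OF k0])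
        show "integrable lborel (\<lambda>p. e * gaussian k m p + exp (- (k - 1) * d\<^sup>2) * (norm (v p) * gaussian 1 m p))"
          by (intro Bochner_Integration.integrable_add integrable_mult_right intv' integral_gaussian k0) simp
        fix p
        have norm_eq: "norm (v p * of_real (gaussian k m p)) = norm (v p) * gaussian k m p"
          by (simp add: norm_mult gaussian_nonneg)
        show "norm (v p * of_real (gaussian k m p))
            \<le> e * gaussian k m p + exp (- (k - 1) * d\<^sup>2) * (norm (v p) * gaussian 1 m p)"
        proof (cases "dist p m < d")
          case True
          then have "norm (v p) * gaussian k m p \<le> e * gaussian k m p"
            using d(2)[of p] by (intro mult_right_mono gaussian_nonneg) auto
          moreover have "0 \<le> exp (- (k - 1) * d\<^sup>2) * (norm (v p) * gaussian 1 m p)"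
            by (simp add: gaussian_nonneg)
          ultimately show ?thesis unfolding norm_eq by linarith
        next
          case False
          \<comment> \<open>At distance r \<ge> d one has k r^2 \<ge> (k-1) d^2 + r^2, which leaves
            a unit Gaussian with a small factor.\<close>
          then have "d\<^sup>2 \<le> (dist p m)\<^sup>2" using d(1) by (intro power_mono) auto
          then have "(k - 1) * d\<^sup>2 \<le> (k - 1) * (dist p m)\<^sup>2" using k by (intro mult_left_mono) auto
          then have "- k * (dist p m)\<^sup>2 \<le> - (k - 1) * d\<^sup>2 + - 1 * (dist p m)\<^sup>2"
            by (simp add: algebra_simps)
          then have "gaussian k m p \<le> exp (- (k - 1) * d\<^sup>2) * gaussian 1 m p"
            unfolding gaussian_eq_exp_dist mult_exp_exp by (simp only: exp_le_cancel_iff)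
          then have "norm (v p) * gaussian k m p \<le> norm (v p) * (exp (- (k - 1) * d\<^sup>2) * gaussian 1 m p)"
            by (intro mult_left_mono) auto
          moreover have "0 \<le> e * gaussian k m p" using \<open>0 < e\<close> by (simp add: gaussian_nonneg)
          ultimately show ?thesis unfolding norm_eq by (simp add: mult_ac)
        qed
      qed
      also have "\<dots> = e * (pi / k) + exp (- (k - 1) * d\<^sup>2) * M"
        unfolding M_def using k0 intv'[of 1] integral_gaussian[OF k0]
        by (subst Bochner_Integration.integral_add) auto
      finally show ?thesis using k0 by (simp add: field_simps)
    qed
    have "eventually (\<lambda>k. norm (w m) * pi \<le> e * pi + M * (k * exp (- (k - 1) * d\<^sup>2))) at_top"
      using eventually_gt_at_top[of 1] by eventually_elim (rule bound)
    moreover have "((\<lambda>k. k * exp (- (k - 1) * d\<^sup>2)) \<longlongrightarrow> 0) at_top"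
      using d(1) by real_asymp
    then have "((\<lambda>k. e * pi + M * (k * exp (- (k - 1) * d\<^sup>2))) \<longlongrightarrow> e * pi + M * 0) at_top"
      by (intro tendsto_intros)
    ultimately have "norm (w m) * pi \<le> e * pi + M * 0"
      by (intro tendsto_lowerbound[where F = at_top]) auto
    then show ?thesis by simp
  qed
  then have "norm (w m) \<le> 0" by (meson dense_ge)
  then show ?thesis by simp
qed

text \<open>Gaussians centred at m are Schwartz functions, so the difference of two representatives
  is orthogonal to all of them. This is what makes the definite description in \<open>A\<close>
  meaningful.\<close>

lemma represents_inv_fourier_unique:
  assumes "continuous_on UNIV u" "represents_inv_fourier u f"
    and "continuous_on UNIV v" "represents_inv_fourier v f"
  shows "u = v"
proof
  fix m
  have g: "integrable lborel (\<lambda>p. u p * of_real (gaussian k m p))"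
    "integrable lborel (\<lambda>p. v p * of_real (gaussian k m p))"
    "(LINT p|lborel. u p * of_real (gaussian k m p)) = (LINT p|lborel. v p * of_real (gaussian k m p))"
    if "0 < k" for k
    using assms(2,4) schwartz_gaussian[OF that, of m] unfolding represents_inv_fourier_def by auto
  have "u m - v m = 0"
  proof (rule continuous_eq_0_if_gaussian_orthogonal[where w = "\<lambda>p. u p - v p"])
    show "continuous_on UNIV (\<lambda>p. u p - v p)" by (intro continuous_intros assms)
    show "integrable lborel (\<lambda>p. (u p - v p) * of_real (gaussian k m p))" if "0 < k" for k
      unfolding left_diff_distrib by (intro Bochner_Integration.integrable_diff g that)
    show "(LINT p|lborel. (u p - v p) * of_real (gaussian k m p)) = 0" if "0 < k" for k
      unfolding left_diff_distrib using g[OF that] by (subst Bochner_Integration.integral_diff) auto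
  qed
  then show "u m = v m" by simp
qed

lemma A_eqI:
  assumes "continuous_on UNIV u" "represents_inv_fourier u (multiplier t)"
  shows "A x y t = u (x, y)"
  unfolding A_def using assms represents_inv_fourier_unique
  by (subst the_equality[where a = u]) auto

subsection \<open>Pointwise bounds\<close>

lemma A_eq_airy_product:
  assumes "0 < t"
  shows "A x y t = airy_product ((2 / t) powr (1 / 3)) (x, y)"
proof (rule A_eqI[OF continuous_on_airy_product represents_airy_product])
  have "((2 / t) powr (1 / 3)) ^ 3 = 2 / t"
    using assms by (subst powr_realpow[symmetric]) (simp_all add: powr_powr)
  then show "t * ((2 / t) powr (1 / 3)) ^ 3 = 2" using assms by simp
qed (use assms in simp_all)

lemma norm_A_eq:
  assumes t: "0 < t" and k: "k = (2 / t) powr (1 / 3)"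
  shows "norm (A x y t) = 2 powr (2 / 3) * sqrt 3 / 2 * t powr (- 2 / 3) *
    (norm (airy (k * (x + sqrt 3 * \<bar>y\<bar>) / 2)) * norm (airy (k * (x - sqrt 3 * \<bar>y\<bar>) / 2)))"
proof -
  have "k\<^sup>2 = (2 / t) powr (2 / 3)"
    using t unfolding k by (subst powr_realpow[symmetric]) (simp_all add: powr_powr)
  also have "\<dots> = 2 powr (2 / 3) * t powr (- 2 / 3)"
    using t by (simp add: powr_divide powr_minus_divide)
  finally have k2: "k\<^sup>2 = 2 powr (2 / 3) * t powr (- 2 / 3)" .
  have "norm (A x y t) = k\<^sup>2 * sqrt 3 / 2 *
      (norm (airy (arg1 k (x, y))) * norm (airy (arg2 k (x, y))))"
    unfolding A_eq_airy_product[OF t, folded k] airy_product_def norm_mult norm_of_real by simp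
  \<comment> \<open>Changing the sign of y only swaps the two arguments, so |y| may be used and the
    first argument is the larger one.\<close>
  also have "norm (airy (arg1 k (x, y))) * norm (airy (arg2 k (x, y)))
      = norm (airy (k * (x + sqrt 3 * \<bar>y\<bar>) / 2)) * norm (airy (k * (x - sqrt 3 * \<bar>y\<bar>) / 2))"
    by (cases "0 \<le> y") (simp_all add: arg1_def arg2_def)
  finally show ?thesis unfolding k2 by (simp add: mult_ac)
qed

text \<open>Three ways to bound the two Airy factors: both by a constant; the one with the larger
  argument by exponential decay; and, for x < 0, the one with the smaller argument by the power
  -1/4.\<close>

lemma A_bounds:
  obtains C where "0 < C"
    "\<And>t x y. 0 < t \<Longrightarrow> norm (A x y t) \<le> C * t powr (- 2 / 3)"
    "\<And>t x y. 0 < t \<Longrightarrow>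
      norm (A x y t) \<le> C * t powr (- 2 / 3) * exp (- ((2 / t) powr (1 / 3) * (x + sqrt 3 * \<bar>y\<bar>) / 2))"
    "\<And>t x y. 0 < t \<Longrightarrow> x < 0 \<Longrightarrow>
      norm (A x y t) \<le> C * t powr (- 2 / 3) * ((2 / t) powr (1 / 3) * \<bar>x\<bar> / 2) powr (- 1 / 4)"
proof -
  obtain B where B: "0 < B" "\<And>s. norm (airy s) \<le> B" "\<And>s. norm (airy s) \<le> B * exp (- s)"
    "\<And>s. s < 0 \<Longrightarrow> norm (airy s) \<le> B * \<bar>s\<bar> powr (- 1 / 4)"
    using airy_bounds by metis
  define c :: real where "c = 2 powr (2 / 3) * sqrt 3 / 2"
  have c: "0 < c" by (simp add: c_def)
  have bound: "norm (A x y t) \<le> c * (B * B) * t powr (- 2 / 3) * r"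
    if "0 < t" "k = (2 / t) powr (1 / 3)"
      "norm (airy (k * (x + sqrt 3 * \<bar>y\<bar>) / 2)) * norm (airy (k * (x - sqrt 3 * \<bar>y\<bar>) / 2)) \<le> B * B * r"
    for t x y k r
  proof -
    have "norm (A x y t) \<le> c * t powr (- 2 / 3) * (B * B * r)"
      unfolding norm_A_eq[OF that(1,2)] c_def[symmetric]
      by (rule mult_left_mono[OF that(3)]) (use c in simp)
    then show ?thesis by (simp add: mult_ac)
  qed
  show thesis
  proof (rule that[of "c * (B * B)"])
    show "0 < c * (B * B)" using B c by simp
    fix t x y :: real assume t: "0 < t"
    define k where "k = (2 / t) powr (1 / 3)"
    have k: "0 < k" using t by (simp add: k_def)
    show "norm (A x y t) \<le> c * (B * B) * t powr (- 2 / 3)"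
      using bound[OF t k_def, of x y 1] B by (simp add: mult_mono)
    have "norm (airy (k * (x + sqrt 3 * \<bar>y\<bar>) / 2)) * norm (airy (k * (x - sqrt 3 * \<bar>y\<bar>) / 2))
        \<le> (B * exp (- (k * (x + sqrt 3 * \<bar>y\<bar>) / 2))) * B"
      using B by (intro mult_mono) auto
    then show "norm (A x y t) \<le> c * (B * B) * t powr (- 2 / 3) * exp (- ((2 / t) powr (1 / 3) * (x + sqrt 3 * \<bar>y\<bar>) / 2))"
      unfolding k_def[symmetric] by (intro bound[OF t k_def]) (simp add: mult_ac)
    assume x: "x < 0"
    define s where "s = k * (x - sqrt 3 * \<bar>y\<bar>) / 2"
    \<comment> \<open>The smaller argument is at most k x/2 < 0, so its modulus is at least k |x|/2,
      and the negative power reverses this inequality.\<close>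
    have "x - sqrt 3 * \<bar>y\<bar> \<le> x" by simp
    then have "s \<le> k * x / 2" unfolding s_def using k by (intro divide_right_mono mult_left_mono) auto
    moreover have "k * x < 0" using k x by (rule mult_pos_neg)
    moreover have "k * \<bar>x\<bar> = - (k * x)" using x by simp
    ultimately have s: "s < 0" "k * \<bar>x\<bar> / 2 \<le> \<bar>s\<bar>" by linarith+
    have "\<bar>s\<bar> powr (- 1 / 4) \<le> (k * \<bar>x\<bar> / 2) powr (- 1 / 4)"
      using s(2) \<open>k * x < 0\<close> \<open>k * \<bar>x\<bar> = - (k * x)\<close> by (intro powr_mono2') auto
    then have "norm (airy s) \<le> B * (k * \<bar>x\<bar> / 2) powr (- 1 / 4)"
      using B(4)[OF s(1)] B(1) by (meson mult_left_mono less_imp_le order_trans)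
    then have "norm (airy (k * (x + sqrt 3 * \<bar>y\<bar>) / 2)) * norm (airy s)
        \<le> B * (B * (k * \<bar>x\<bar> / 2) powr (- 1 / 4))"
      using B by (intro mult_mono) auto
    then show "norm (A x y t) \<le> c * (B * B) * t powr (- 2 / 3) * ((2 / t) powr (1 / 3) * \<bar>x\<bar> / 2) powr (- 1 / 4)"
      unfolding k_def[symmetric] s_def by (intro bound[OF t k_def]) (simp add: mult_ac)
  qed
qed

section \<open>Exponential decay in terms of the Japanese bracket\<close>

lemma japanese_ge_1: "1 \<le> \<langle>a\<rangle>"
  unfolding japanese_def by (rule ge_one_powr_ge_zero) simp_all

lemma japanese_le:
  assumes "0 \<le> a"
  shows "\<langle>a\<rangle> \<le> 1 + a"
proof -
  have "\<langle>a\<rangle> = sqrt (1 + a\<^sup>2)" unfolding japanese_def by (rule powr_half_sqrt) simp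
  also have "\<dots> \<le> 1 + a"
    using assms by (intro real_le_lsqrt) (simp_all add: power2_sum)
  finally show ?thesis .
qed

lemma exp_le_japanese_powr:
  fixes \<alpha> :: real
  assumes "0 \<le> \<alpha>"
  obtains K where "0 < K" "\<And>w. 0 \<le> w \<Longrightarrow> exp (- (w powr (2 / 3) / 2)) \<le> K * \<langle>w\<rangle> powr (- \<alpha>)"
proof -
  \<comment> \<open>Chosen so that 2 \<alpha>/N \<le> 1: after raising to the power 2 \<alpha>, the
    factor exp(v/N) still stays below exp(v).\<close>
  define N where "N = 2 * \<alpha> + 1"
  have N: "1 \<le> N" using assms by (simp add: N_def)
  show thesis
  proof (rule that[of "(2 * N) powr (2 * \<alpha>)"])
    show "0 < (2 * N) powr (2 * \<alpha>)" using N by simp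
    fix w :: real assume w: "0 \<le> w"
    define v where "v = w powr (2 / 3) / 2"
    have v: "0 \<le> v" by (simp add: v_def)
    have w_eq: "w = (2 * v) powr (3 / 2)" using w by (simp add: v_def powr_powr)
    \<comment> \<open>Here w = (2v)^(3/2), and 3/2 lies between 1 and 2: it is compared with 2v when
      2v \<le> 1 and with (2v)^2 otherwise.\<close>
    have "w \<le> (1 + 2 * v)\<^sup>2 - 1"
    proof (cases "2 * v \<le> 1")
      case True
      have "(2 * v) powr (3 / 2) \<le> (2 * v) powr 1" using True v by (intro powr_mono') auto
      moreover have "(1 + 2 * v)\<^sup>2 - 1 = 4 * v\<^sup>2 + 4 * v"
        by (simp add: power2_sum power_mult_distrib)
      ultimately show ?thesis using v zero_le_power2[of v] unfolding w_eq[symmetric] powr_one[OF mult_nonneg_nonneg[OF zero_le_numeral v]]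
        by linarith
    next
      case False
      have "(2 * v) powr (3 / 2) \<le> (2 * v) powr 2" using False by (intro powr_mono) auto
      then show ?thesis using v unfolding w_eq[symmetric] by (simp add: powr_numeral power2_sum power_mult_distrib)
    qed
    then have "\<langle>w\<rangle> \<le> (1 + 2 * v)\<^sup>2" using japanese_le[OF w] by linarith
    then have "\<langle>w\<rangle> powr \<alpha> \<le> ((1 + 2 * v)\<^sup>2) powr \<alpha>"
      using assms japanese_ge_1[of w] by (intro powr_mono2) auto
    also have "\<dots> = (1 + 2 * v) powr (2 * \<alpha>)"
      using v by (simp add: powr_powr flip: powr_numeral)
    also have "\<dots> \<le> (2 * N * exp (v / N)) powr (2 * \<alpha>)"
    proof (rule powr_mono2)
      have "1 + 2 * v \<le> 2 * N * (1 + v / N)" using N v by (simp add: field_simps)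
      also have "\<dots> \<le> 2 * N * exp (v / N)" using N by (intro mult_left_mono exp_ge_add_one_self) auto
      finally show "1 + 2 * v \<le> 2 * N * exp (v / N)" .
    qed (use v assms in auto)
    also have "\<dots> = (2 * N) powr (2 * \<alpha>) * exp (2 * \<alpha> * (v / N))"
      using N by (simp add: powr_mult exp_powr_real mult_ac)
    also have "\<dots> \<le> (2 * N) powr (2 * \<alpha>) * exp v"
    proof -
      have "2 * \<alpha> * v \<le> N * v" using v by (intro mult_right_mono) (auto simp: N_def)
      then have "2 * \<alpha> * (v / N) \<le> v" using N by (simp add: field_simps)
      then show ?thesis by (intro mult_left_mono) auto
    qed
    finally have "\<langle>w\<rangle> powr \<alpha> \<le> (2 * N) powr (2 * \<alpha>) * exp v" .
    moreover have "0 < \<langle>w\<rangle>" using japanese_ge_1[of w] by linarith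
    ultimately show "exp (- (w powr (2 / 3) / 2)) \<le> (2 * N) powr (2 * \<alpha>) * \<langle>w\<rangle> powr (- \<alpha>)"
      unfolding v_def[symmetric] by (simp add: exp_minus powr_minus field_simps)
  qed
qed

text \<open>The power 2/3 of X^(3/2) t^(-1/2) is X t^(-1/3), the natural scale of the Airy
  arguments. X = |x| gives \<lambda>, and X = |y| gives \<lambda> |z|^(3/2).\<close>

lemma scaled_argument:
  fixes t X Y :: real
  assumes "0 < t" "0 \<le> X" "X \<le> Y"
  shows "(X powr (3 / 2) * t powr (- 1 / 2)) powr (2 / 3) / 2 \<le> (2 / t) powr (1 / 3) * Y / 2"
proof -
  have "(X powr (3 / 2) * t powr (- 1 / 2)) powr (2 / 3) = X * t powr (- 1 / 3)"
    using assms by (simp add: powr_mult powr_powr)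
  also have "\<dots> \<le> Y * (2 / t) powr (1 / 3)"
  proof (rule mult_mono)
    have "t powr (- 1 / 3) = (1 / t) powr (1 / 3)"
      using assms by (simp add: powr_divide powr_minus_divide)
    also have "\<dots> \<le> (2 / t) powr (1 / 3)"
      using assms by (intro powr_mono2) (auto simp: divide_right_mono)
    finally show "t powr (- 1 / 3) \<le> (2 / t) powr (1 / 3)" .
  qed (use assms in auto)
  finally show ?thesis by (simp add: mult.commute)
qed

text \<open>The free parameter X serves two regions: X = x for x > 0, and X = |y| where |y| \<ge> 4
  |x|.\<close>

lemma A_decay:
  assumes "0 \<le> \<alpha>"
  obtains C where "0 < C"
    "\<And>t x y X. 0 < t \<Longrightarrow> 0 \<le> X \<Longrightarrow> X \<le> x + sqrt 3 * \<bar>y\<bar> \<Longrightarrow>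
      norm (A x y t) \<le> C * t powr (- 2 / 3) * \<langle>X powr (3 / 2) * t powr (- 1 / 2)\<rangle> powr (- \<alpha>)"
proof -
  obtain C where C: "0 < C" "\<And>t x y. 0 < t \<Longrightarrow>
      norm (A x y t) \<le> C * t powr (- 2 / 3) * exp (- ((2 / t) powr (1 / 3) * (x + sqrt 3 * \<bar>y\<bar>) / 2))"
    using A_bounds by metis
  obtain K where K: "0 < K" "\<And>w. 0 \<le> w \<Longrightarrow> exp (- (w powr (2 / 3) / 2)) \<le> K * \<langle>w\<rangle> powr (- \<alpha>)"
    using exp_le_japanese_powr[OF assms] by metis
  show thesis
  proof (rule that[of "C * K"])
    show "0 < C * K" using C K by simp
    fix t x y X :: real assume t: "0 < t" and X: "0 \<le> X" "X \<le> x + sqrt 3 * \<bar>y\<bar>"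
    define w where "w = X powr (3 / 2) * t powr (- 1 / 2)"
    have "exp (- ((2 / t) powr (1 / 3) * (x + sqrt 3 * \<bar>y\<bar>) / 2)) \<le> exp (- (w powr (2 / 3) / 2))"
      using scaled_argument[OF t X] by (simp add: w_def)
    also have "\<dots> \<le> K * \<langle>w\<rangle> powr (- \<alpha>)" by (rule K) (simp add: w_def)
    finally have "C * t powr (- 2 / 3) * exp (- ((2 / t) powr (1 / 3) * (x + sqrt 3 * \<bar>y\<bar>) / 2))
        \<le> C * t powr (- 2 / 3) * (K * \<langle>w\<rangle> powr (- \<alpha>))"
      using C by (intro mult_left_mono) auto
    then show "norm (A x y t) \<le> C * K * t powr (- 2 / 3) * \<langle>X powr (3 / 2) * t powr (- 1 / 2)\<rangle> powr (- \<alpha>)"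
      unfolding w_def[symmetric] using C(2)[OF t, of x y] by (simp add: mult_ac)
  qed
qed

lemma A_decay_outer:
  assumes "0 \<le> \<beta>"
  obtains C where "0 < C"
    "\<And>t x y. 0 < t \<Longrightarrow> x \<noteq> 0 \<Longrightarrow> 4 \<le> \<bar>y / \<bar>x\<bar>\<bar> \<Longrightarrow>
      norm (A x y t) \<le> C * t powr (- 2 / 3) *
        \<langle>\<bar>x\<bar> powr (3 / 2) * t powr (- 1 / 2) * \<bar>y / \<bar>x\<bar>\<bar> powr (3 / 2)\<rangle> powr (- \<beta>)"
proof -
  obtain C where C: "0 < C" "\<And>t x y X. 0 < t \<Longrightarrow> 0 \<le> X \<Longrightarrow> X \<le> x + sqrt 3 * \<bar>y\<bar> \<Longrightarrow>
      norm (A x y t) \<le> C * t powr (- 2 / 3) * \<langle>X powr (3 / 2) * t powr (- 1 / 2)\<rangle> powr (- \<beta>)"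
    using A_decay[OF assms] by metis
  show thesis
  proof (rule that[OF C(1)])
    fix t x y :: real assume t: "0 < t" and x: "x \<noteq> 0" and y: "4 \<le> \<bar>y / \<bar>x\<bar>\<bar>"
    have "4 * \<bar>x\<bar> \<le> \<bar>y\<bar>" using x y by (simp add: field_simps)
    \<comment> \<open>With |x| \<le> |y|/4 and sqrt(3) \<ge> 3/2, the sum x + sqrt(3) |y| is at
      least 5|y|/4 for either sign of x.\<close>
    moreover have "3 / 2 \<le> sqrt 3" by (rule real_le_rsqrt) (simp add: power2_eq_square)
    then have "3 / 2 * \<bar>y\<bar> \<le> sqrt 3 * \<bar>y\<bar>" by (rule mult_right_mono) simp
    ultimately have "\<bar>y\<bar> \<le> x + sqrt 3 * \<bar>y\<bar>" by linarith
    moreover have "\<bar>x\<bar> powr (3 / 2) * t powr (- 1 / 2) * \<bar>y / \<bar>x\<bar>\<bar> powr (3 / 2)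
        = \<bar>y\<bar> powr (3 / 2) * t powr (- 1 / 2)"
      using x by (simp add: powr_divide)
    ultimately show "norm (A x y t) \<le> C * t powr (- 2 / 3) *
        \<langle>\<bar>x\<bar> powr (3 / 2) * t powr (- 1 / 2) * \<bar>y / \<bar>x\<bar>\<bar> powr (3 / 2)\<rangle> powr (- \<beta>)"
      using C(2)[OF t, of "\<bar>y\<bar>" x y] by (simp only: abs_ge_zero)
  qed
qed

text \<open>The smaller Airy argument has modulus at least \<lambda>^(2/3)/2, and its power -1/4
  gives \<lambda>^(-1/6).\<close>

lemma A_decay_inner_neg:
  obtains C where "0 < C"
    "\<And>t x y. 0 < t \<Longrightarrow> x < 0 \<Longrightarrow>
      norm (A x y t) \<le> C * t powr (- 2 / 3) * \<langle>\<bar>x\<bar> powr (3 / 2) * t powr (- 1 / 2)\<rangle> powr (- 1 / 6)"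
proof -
  obtain C where C: "0 < C" "\<And>t x y. 0 < t \<Longrightarrow> norm (A x y t) \<le> C * t powr (- 2 / 3)"
    "\<And>t x y. 0 < t \<Longrightarrow> x < 0 \<Longrightarrow>
      norm (A x y t) \<le> C * t powr (- 2 / 3) * ((2 / t) powr (1 / 3) * \<bar>x\<bar> / 2) powr (- 1 / 4)"
    using A_bounds by metis
  show thesis
  proof (rule that[of "C * 2"])
    show "0 < C * 2" using C by simp
    fix t x y :: real assume t: "0 < t" and x: "x < 0"
    define w where "w = \<bar>x\<bar> powr (3 / 2) * t powr (- 1 / 2)"
    have w: "0 < w" using t x by (simp add: w_def)
    have Ct: "0 \<le> C * t powr (- 2 / 3)" using C by simp
    have J: "0 < \<langle>w\<rangle>" using japanese_ge_1[of w] by linarith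
    \<comment> \<open>For w \<le> 1 the bracket is at most 2 and the uniform bound suffices with r =
      1; for w > 1 the bracket is at most 2w and the power bound is used.\<close>
    have "\<exists>r. norm (A x y t) \<le> C * t powr (- 2 / 3) * r \<and> r \<le> 2 * \<langle>w\<rangle> powr (- 1 / 6)"
    proof (cases "w \<le> 1")
      case True
      then have "\<langle>w\<rangle> \<le> 2" using japanese_le[of w] w by linarith
      then have "2 powr (- 1 / 6) \<le> \<langle>w\<rangle> powr (- 1 / 6)" using J by (intro powr_mono2') auto
      moreover have "2 powr - 1 \<le> (2::real) powr (- 1 / 6)" by (intro powr_mono) auto
      ultimately have "1 \<le> 2 * \<langle>w\<rangle> powr (- 1 / 6)" by (simp add: powr_minus)
      then show ?thesis using C(2)[OF t, of x y] by (intro exI[of _ 1]) simp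
    next
      case False
      define u where "u = (2 / t) powr (1 / 3) * \<bar>x\<bar> / 2"
      have u: "w powr (2 / 3) / 2 \<le> u"
        using scaled_argument[OF t, of "\<bar>x\<bar>" "\<bar>x\<bar>"] by (simp add: w_def u_def)
      have "\<langle>w\<rangle> \<le> 2 * w" using japanese_le[of w] w False by linarith
      then have "\<langle>w\<rangle> powr (2 / 3) / 4 \<le> (2 * w) powr (2 / 3) / 4"
        using J by (intro divide_right_mono powr_mono2) auto
      also have "\<dots> = 2 powr (2 / 3) * w powr (2 / 3) / 4" using w by (simp add: powr_mult)
      also have "\<dots> \<le> 2 powr 1 * w powr (2 / 3) / 4"
        by (intro divide_right_mono mult_right_mono powr_mono) auto
      also have "\<dots> \<le> u" using u by simp
      finally have "u powr (- 1 / 4) \<le> (\<langle>w\<rangle> powr (2 / 3) / 4) powr (- 1 / 4)"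
        using J by (intro powr_mono2') auto
      also have "\<dots> = 4 powr (1 / 4) * \<langle>w\<rangle> powr (- 1 / 6)"
        using J by (simp add: powr_divide powr_powr powr_minus field_simps)
      also have "\<dots> \<le> 4 powr (1 / 2) * \<langle>w\<rangle> powr (- 1 / 6)"
        by (intro mult_right_mono powr_mono) auto
      also have "(4::real) powr (1 / 2) = 2" by (simp add: powr_half_sqrt)
      finally show ?thesis using C(3)[OF t x, of y] by (auto simp: u_def)
    qed
    then obtain r where r: "norm (A x y t) \<le> C * t powr (- 2 / 3) * r" "r \<le> 2 * \<langle>w\<rangle> powr (- 1 / 6)"
      by blast
    from r(1) mult_left_mono[OF r(2) Ct]
    have "norm (A x y t) \<le> C * t powr (- 2 / 3) * (2 * \<langle>w\<rangle> powr (- 1 / 6))"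
      by (rule order_trans)
    then show "norm (A x y t) \<le> C * 2 * t powr (- 2 / 3) * \<langle>\<bar>x\<bar> powr (3 / 2) * t powr (- 1 / 2)\<rangle> powr (- 1 / 6)"
      unfolding w_def[symmetric] by (simp add: mult_ac)
  qed
qed

theorem proposition9p1:
  shows
    "(\<forall>\<alpha>::real. \<forall>\<beta>::real. 0 \<le> \<alpha> \<longrightarrow> 0 \<le> \<beta> \<longrightarrow>
       (\<exists>C::real. \<forall>t x y::real. 0 < t \<longrightarrow> 0 < x \<longrightarrow>
         (let lam = \<bar>x\<bar> powr (3 / 2) * t powr (- 1 / 2); z = y / \<bar>x\<bar> in
            (\<bar>z\<bar> \<le> 4 \<longrightarrow> norm (A x y t) \<le> C * t powr (- 2 / 3) * \<langle>lam\<rangle> powr (- \<alpha>)) \<and>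
            (4 \<le> \<bar>z\<bar> \<longrightarrow>
               norm (A x y t) \<le> C * t powr (- 2 / 3) * \<langle>lam * \<bar>z\<bar> powr (3 / 2)\<rangle> powr (- \<beta>)))))
     \<and>
     (\<forall>\<beta>::real. 0 \<le> \<beta> \<longrightarrow>
       (\<exists>C::real. \<forall>t x y::real. 0 < t \<longrightarrow> x < 0 \<longrightarrow>
         (let lam = \<bar>x\<bar> powr (3 / 2) * t powr (- 1 / 2); z = y / \<bar>x\<bar> in
            (\<bar>z\<bar> \<le> 4 \<longrightarrow> norm (A x y t) \<le> C * t powr (- 2 / 3) * \<langle>lam\<rangle> powr (- 1 / 6)) \<and>
            (4 \<le> \<bar>z\<bar> \<longrightarrow>
               norm (A x y t) \<le> C * t powr (- 2 / 3) * \<langle>lam * \<bar>z\<bar> powr (3 / 2)\<rangle> powr (- \<beta>)))))"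
proof -
  \<comment> \<open>One constant must serve both ranges of z; the sum of the two separate constants
    is taken.\<close>
  have enlarge: "a \<le> (C + D) * p * q" if "a \<le> C * p * q" "0 < D" "0 \<le> p" "0 \<le> q" for a C D p q :: real
    using that by (simp add: distrib_right add_increasing2)
  have enlarge': "a \<le> (C + D) * p * q" if "a \<le> D * p * q" "0 < C" "0 \<le> p" "0 \<le> q" for a C D p q :: real
    using that by (simp add: distrib_right add_increasing)
  show ?thesis
  proof (intro conjI allI impI)
    fix \<alpha> \<beta> :: real assume \<alpha>: "0 \<le> \<alpha>" and \<beta>: "0 \<le> \<beta>"
    obtain C where C: "0 < C" "\<And>t x y X. 0 < t \<Longrightarrow> 0 \<le> X \<Longrightarrow> X \<le> x + sqrt 3 * \<bar>y\<bar> \<Longrightarrow>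
        norm (A x y t) \<le> C * t powr (- 2 / 3) * \<langle>X powr (3 / 2) * t powr (- 1 / 2)\<rangle> powr (- \<alpha>)"
      using A_decay[OF \<alpha>] by metis
    obtain D where D: "0 < D" "\<And>t x y. 0 < t \<Longrightarrow> x \<noteq> 0 \<Longrightarrow> 4 \<le> \<bar>y / \<bar>x\<bar>\<bar> \<Longrightarrow>
        norm (A x y t) \<le> D * t powr (- 2 / 3) *
          \<langle>\<bar>x\<bar> powr (3 / 2) * t powr (- 1 / 2) * \<bar>y / \<bar>x\<bar>\<bar> powr (3 / 2)\<rangle> powr (- \<beta>)"
      using A_decay_outer[OF \<beta>] by metis
    have inner: "norm (A x y t) \<le> C * t powr (- 2 / 3) * \<langle>\<bar>x\<bar> powr (3 / 2) * t powr (- 1 / 2)\<rangle> powr (- \<alpha>)"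
      if "0 < t" "0 < x" for t x y
      using C(2)[OF that(1), of "\<bar>x\<bar>" x y] that(2) by simp
    show "\<exists>C. \<forall>t x y. 0 < t \<longrightarrow> 0 < x \<longrightarrow>
         (let lam = \<bar>x\<bar> powr (3 / 2) * t powr (- 1 / 2); z = y / \<bar>x\<bar> in
            (\<bar>z\<bar> \<le> 4 \<longrightarrow> norm (A x y t) \<le> C * t powr (- 2 / 3) * \<langle>lam\<rangle> powr (- \<alpha>)) \<and>
            (4 \<le> \<bar>z\<bar> \<longrightarrow>
               norm (A x y t) \<le> C * t powr (- 2 / 3) * \<langle>lam * \<bar>z\<bar> powr (3 / 2)\<rangle> powr (- \<beta>)))"
      unfolding Let_def
      by (intro exI[of _ "C + D"] allI impI conjI)
         ((rule enlarge[OF inner] enlarge'[OF D(2)]; use C D in simp)+)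
  next
    fix \<beta> :: real assume \<beta>: "0 \<le> \<beta>"
    obtain C where C: "0 < C" "\<And>t x y. 0 < t \<Longrightarrow> x < 0 \<Longrightarrow>
        norm (A x y t) \<le> C * t powr (- 2 / 3) * \<langle>\<bar>x\<bar> powr (3 / 2) * t powr (- 1 / 2)\<rangle> powr (- 1 / 6)"
      using A_decay_inner_neg by metis
    obtain D where D: "0 < D" "\<And>t x y. 0 < t \<Longrightarrow> x \<noteq> 0 \<Longrightarrow> 4 \<le> \<bar>y / \<bar>x\<bar>\<bar> \<Longrightarrow>
        norm (A x y t) \<le> D * t powr (- 2 / 3) *
          \<langle>\<bar>x\<bar> powr (3 / 2) * t powr (- 1 / 2) * \<bar>y / \<bar>x\<bar>\<bar> powr (3 / 2)\<rangle> powr (- \<beta>)"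
      using A_decay_outer[OF \<beta>] by metis
    show "\<exists>C. \<forall>t x y. 0 < t \<longrightarrow> x < 0 \<longrightarrow>
         (let lam = \<bar>x\<bar> powr (3 / 2) * t powr (- 1 / 2); z = y / \<bar>x\<bar> in
            (\<bar>z\<bar> \<le> 4 \<longrightarrow> norm (A x y t) \<le> C * t powr (- 2 / 3) * \<langle>lam\<rangle> powr (- 1 / 6)) \<and>
            (4 \<le> \<bar>z\<bar> \<longrightarrow>
               norm (A x y t) \<le> C * t powr (- 2 / 3) * \<langle>lam * \<bar>z\<bar> powr (3 / 2)\<rangle> powr (- \<beta>)))"
      unfolding Let_def
      by (intro exI[of _ "C + D"] allI impI conjI)
         ((rule enlarge[OF C(2)] enlarge'[OF D(2)]; use C D in simp)+)
  qed
qed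

end
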